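(* Let $p\in[1,2]$ and let $(X,\|\cdot\|)$ be a normed space of type $p$. Then for any $n\ge1$, any $f:\{-1,1\}^n\to X$, and any nonnegative numbers $\{a_j,b_j\}_{j=1}^n$ with $b_j\ge a_j$, $\|D_jf\|_1\le a_j$ and $\|D_jf\|_p\le b_j$ for $j=1,\dots,n$, we have $$\|f-\mathbb{E}f\|_p\;\le\;\frac{2e\sqrt{2\pi}\;T_p(X)}{\sqrt{\log\left(e\big/\max_{1\le j\le n}\frac{a_j}{b_j}\right)}}\left(\sum_{k=1}^n b_k^p\right)^{1/p}.$$
   Context: $\{-1,1\}^n$ carries the uniform probability measure, with expectation $\mathbb{E}$. For $f:\{-1,1\}^n\to X$ and $1\le q<\infty$, $\|f\|_q=(\mathbb{E}\|f(\varepsilon)\|^q)^{1/q}$. The discrete derivative is $D_jf(\varepsilon)=\frac{f(\varepsilon)-f(\varepsilon^{\oplus j})}{2}$, where $\varepsilon^{\oplus j}=(\varepsilon_1,\dots,-\varepsilon_j,\dots,\varepsilon_n)$. $\log$ is the natural logarithm. A normed space $X$ is of (Rademacher) type $p\in[1,2]$ if there is a finite constant $T$ such that $\mathbb{E}\|\sum_{j=1}^n\varepsilon_jx_j\|^p\le T^p\sum_{j=1}^n\|x_j\|^p$ for all $n\ge1$ and all $x_1,\dots,x_n\in X$, where $\varepsilon$ is uniform on $\{-1,1\}^n$. The best (smallest) such $T$ is $T_p(X)$. Conventions: in the maximum, a ratio $0/0$ is read as $0$. If the maximum is $0$, then $\log(e/0)=+\infty$ and the right-hand side is read as $0$. *)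

theory Defs
  imports "HOL-Analysis.Analysis"
begin

text \<open>
  Points of the discrete cube are functions on the index set \<open>{1..n}\<close> with values in
  \<open>{-1, 1}\<close>, made extensional so that the cube is a finite set with \<open>2 ^ n\<close> elements.
\<close>

definition cube :: "nat \<Rightarrow> (nat \<Rightarrow> real) set" where
  "cube n = {1..n} \<rightarrow>\<^sub>E {- 1, 1}"

text \<open>
  The expectation with respect to the uniform probability measure is written as a finite
  average, because the Bochner integral is only available for complete separable spaces and the
  target space here is an arbitrary normed space.
\<close>

definition cube_expectation :: "nat \<Rightarrow> ((nat \<Rightarrow> real) \<Rightarrow> 'a::real_normed_vector) \<Rightarrow> 'a" where
  "cube_expectation n f = (\<Sum>\<epsilon>\<in>cube n. f \<epsilon>) /\<^sub>R real (card (cube n))"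

definition cube_Lnorm :: "nat \<Rightarrow> real \<Rightarrow> ((nat \<Rightarrow> real) \<Rightarrow> 'a::real_normed_vector) \<Rightarrow> real" where
  "cube_Lnorm n q f = cube_expectation n (\<lambda>\<epsilon>. norm (f \<epsilon>) powr q) powr (1 / q)"

definition discrete_deriv ::
  "nat \<Rightarrow> ((nat \<Rightarrow> real) \<Rightarrow> 'a::real_normed_vector) \<Rightarrow> (nat \<Rightarrow> real) \<Rightarrow> 'a" where
  "discrete_deriv j f \<epsilon> = (f \<epsilon> - f (\<epsilon>(j := - \<epsilon> j))) /\<^sub>R 2"

text \<open>
  The normed space is the type \<open>'a\<close>, passed as \<open>TYPE('a)\<close>. Admissible constants are required
  to be nonnegative, since \<open>powr\<close> is not meaningful for a negative base.
\<close>

definition type_constants :: "'a::real_normed_vector itself \<Rightarrow> real \<Rightarrow> real set" where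
  "type_constants X p = {T. 0 \<le> T \<and>
     (\<forall>n\<ge>1. \<forall>x :: nat \<Rightarrow> 'a.
        cube_expectation n (\<lambda>\<epsilon>. norm (\<Sum>j=1..n. \<epsilon> j *\<^sub>R x j) powr p)
          \<le> T powr p * (\<Sum>j=1..n. norm (x j) powr p))}"

definition has_rademacher_type :: "'a::real_normed_vector itself \<Rightarrow> real \<Rightarrow> bool" where
  "has_rademacher_type X p \<longleftrightarrow> p \<in> {1..2} \<and> type_constants X p \<noteq> {}"

text \<open>
  If the space has type \<open>p\<close>, the set of admissible constants is nonempty, closed and bounded
  below, so this infimum is its least element.
\<close>

definition type_const :: "'a::real_normed_vector itself \<Rightarrow> real \<Rightarrow> real" where
  "type_const X p = Inf (type_constants X p)"

lemma type_const_in_type_constants: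
  fixes X :: "'a::real_normed_vector itself"
  assumes "has_rademacher_type X p"
  shows "type_const X p \<in> type_constants X p"
proof -
  have p: "p > 0" and ne: "type_constants X p \<noteq> {}"
    using assms by (auto simp: has_rademacher_type_def)
  have bdd: "bdd_below (type_constants X p)"
    by (rule bdd_belowI[of _ 0]) (auto simp: type_constants_def)
  have cont: "continuous_on {0..} (\<lambda>T::real. T powr p * c)" for c
    using p by (intro continuous_intros continuous_on_powr') auto
  have cl: "closed {T \<in> {0..}. d \<le> T powr p * c}" for c d :: real
    using continuous_closed_preimage[OF cont closed_atLeast closed_atLeast, of c d]
    by (simp add: vimage_def Int_def)
  have "type_constants X p = {0..} \<inter> (\<Inter>n\<in>{1..}. \<Inter>x :: nat \<Rightarrow> 'a.
      {T \<in> {0..}. cube_expectation n (\<lambda>\<epsilon>. norm (\<Sum>j=1..n. \<epsilon> j *\<^sub>R x j) powr p)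
          \<le> T powr p * (\<Sum>j=1..n. norm (x j) powr p)})"
    by (auto simp: type_constants_def)
  also have "closed \<dots>"
    by (intro closed_Int closed_atLeast closed_INT ballI cl)
  finally show ?thesis
    unfolding type_const_def using closed_contains_Inf[OF ne bdd] by blast
qed

end

theory Submission
  imports Defs
begin

text \<open>
  The proof is the semigroup argument for influence inequalities. Let \<open>noise n r\<close> be the noise
  operator on the cube with correlation \<open>r\<close>; it is the mean for \<open>r = 0\<close> and the identity for
  \<open>r = 1\<close>, so \<open>f - cube_expectation n f\<close> is the integral over \<open>r\<close> of the derivative of \<open>noise n r f\<close>,
  and it suffices to bound the \<open>L\<^sup>p\<close> norm of this derivative.

  The derivative has a probabilistic form (\<open>noise_deriv_gradient\<close>): up to the factor
  \<open>1 / (1 - r\<^sup>2)\<close>, its value at \<open>\<epsilon>\<close> is the average over \<open>\<eta>\<close>, distributed according to the noise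
  kernel, of the sum over \<open>j\<close> of \<open>\<epsilon> j * \<eta> j - r\<close> times the \<open>j\<close>-th discrete derivative at \<open>\<eta>\<close>. If
  \<open>\<epsilon>\<close> is uniform, the factors \<open>\<epsilon> j * \<eta> j - r\<close> are independent centred biased signs, independent of
  the point \<open>\<eta>\<close>, which is uniform too. Symmetrization
  turns them into fair signs, to which the type \<open>p\<close> inequality applies (\<open>biased_type_inequality\<close>).
  This alone bounds the norm of \<open>f - cube_expectation n f\<close> by a constant times
  \<open>T * (\<Sum>j=1..n. b j powr p) powr (1 / p)\<close>, without a logarithm.

  The logarithm comes from smoothing. By the semigroup law, half of the noise can be applied to \<open>f\<close>
  before the derivative formula is used, so that the discrete derivatives of \<open>noise n r f\<close> occur
  instead of those of \<open>f\<close>. They are dominated by noise applied to the scalar functions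
  \<open>norm (discrete_deriv j f \<epsilon>)\<close>, and hypercontractivity (\<open>noise_hypercontractive\<close>,
  \<open>noise_interpolation\<close>) bounds their \<open>L\<^sup>p\<close> norms by \<open>a j powr \<theta> * b j powr (1 - \<theta>)\<close>, with
  \<open>\<theta> = (1 - r\<^sup>2) / (1 + r\<^sup>2)\<close>. If \<open>a j \<le> M * b j\<close> for all \<open>j\<close>, each gains a factor \<open>M powr \<theta>\<close>.

  With the parametrization \<open>r = sin x\<close> it remains to integrate \<open>M powr \<theta>\<close> over \<open>x\<close> from \<open>0\<close> to
  \<open>pi / 2\<close>. As \<open>\<theta>\<close> vanishes only at \<open>x = pi / 2\<close>, to second order, the integral is of order
  \<open>1 / sqrt (1 + ln (1 / M))\<close>; the elementary bound \<open>exp (- y) \<le> 1 / (1 + y)\<close> makes it an explicit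
  arctangent. The resulting constant \<open>2 * sqrt 2 * pi\<close> (\<open>Talagrand_influence_type\<close>) is smaller than
  the constant \<open>2 * exp 1 * sqrt (2 * pi)\<close> of the final statement.
\<close>

section \<open>Inequalities for weighted sums\<close>

text \<open>
  The pointwise weighted AM-GM inequality, applied after normalising both sums to \<open>1\<close>. If one
  of the sums vanishes then so does every term on the left; by \<open>0 powr 0 = 0\<close> this is true even for
  the exponent \<open>0\<close>.
\<close>

lemma weighted_Holder:
  fixes w u v :: "'i \<Rightarrow> real"
  assumes fin: "finite I" and "0 \<le> \<alpha>" "0 \<le> \<beta>" "\<alpha> + \<beta> = 1"
    and w: "\<And>i. i \<in> I \<Longrightarrow> 0 \<le> w i" and u: "\<And>i. i \<in> I \<Longrightarrow> 0 \<le> u i"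
    and v: "\<And>i. i \<in> I \<Longrightarrow> 0 \<le> v i"
  shows "(\<Sum>i\<in>I. w i * (u i powr \<alpha> * v i powr \<beta>))
    \<le> (\<Sum>i\<in>I. w i * u i) powr \<alpha> * (\<Sum>i\<in>I. w i * v i) powr \<beta>"
proof -
  define U where "U = (\<Sum>i\<in>I. w i * u i)"
  define V where "V = (\<Sum>i\<in>I. w i * v i)"
  have U0: "0 \<le> U" and V0: "0 \<le> V"
    unfolding U_def V_def using w u v by (auto intro!: sum_nonneg)
  show ?thesis
  proof (cases "U = 0 \<or> V = 0")
    case True
    have "w i * (u i powr \<alpha> * v i powr \<beta>) = 0" if "i \<in> I" for i
    proof -
      have "w i * u i = 0 \<or> w i * v i = 0"
        using True that fin w u v unfolding U_def V_def
        by (auto simp: sum_nonneg_eq_0_iff)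
      then show ?thesis by auto
    qed
    then have "(\<Sum>i\<in>I. w i * (u i powr \<alpha> * v i powr \<beta>)) = 0"
      by (intro sum.neutral) blast
    then show ?thesis by (metis powr_ge_zero mult_nonneg_nonneg)
  next
    case False
    with U0 V0 have pos: "0 < U" "0 < V" by auto
    have young: "u i powr \<alpha> * v i powr \<beta> \<le> U powr \<alpha> * V powr \<beta> * (\<alpha> * (u i / U) + \<beta> * (v i / V))"
      if "i \<in> I" for i
    proof (cases "u i = 0 \<or> v i = 0")
      case True
      then show ?thesis using assms pos that by auto
    next
      case False
      with u v that have "0 < u i" "0 < v i" by (auto simp: less_eq_real_def)
      then have "(u i / U) powr \<alpha> * (v i / V) powr \<beta> \<le> \<alpha> * (u i / U) + \<beta> * (v i / V)"
        using assms pos by (intro Youngs_inequality_0) auto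
      then have "U powr \<alpha> * V powr \<beta> * ((u i / U) powr \<alpha> * (v i / V) powr \<beta>)
          \<le> U powr \<alpha> * V powr \<beta> * (\<alpha> * (u i / U) + \<beta> * (v i / V))"
        by (intro mult_left_mono) auto
      then show ?thesis using pos \<open>0 < u i\<close> \<open>0 < v i\<close> by (simp add: powr_divide)
    qed
    have "(\<Sum>i\<in>I. w i * (u i powr \<alpha> * v i powr \<beta>))
        \<le> (\<Sum>i\<in>I. w i * (U powr \<alpha> * V powr \<beta> * (\<alpha> * (u i / U) + \<beta> * (v i / V))))"
      using young w by (intro sum_mono mult_left_mono) auto
    also have "\<dots> = U powr \<alpha> * V powr \<beta>
        * (\<alpha> * ((\<Sum>i\<in>I. w i * u i) / U) + \<beta> * ((\<Sum>i\<in>I. w i * v i) / V))"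
      by (simp add: sum.distrib sum_distrib_left sum_divide_distrib algebra_simps)
    finally show ?thesis using pos assms by (simp flip: U_def V_def)
  qed
qed

text \<open>
  Hoelder's inequality against the constant function \<open>1\<close>.
\<close>

lemma powr_Jensen:
  fixes w x :: "'i \<Rightarrow> real"
  assumes fin: "finite I" and p: "1 \<le> p"
    and w: "\<And>i. i \<in> I \<Longrightarrow> 0 \<le> w i" "(\<Sum>i\<in>I. w i) = 1"
    and x: "\<And>i. i \<in> I \<Longrightarrow> 0 \<le> x i"
  shows "(\<Sum>i\<in>I. w i * x i) powr p \<le> (\<Sum>i\<in>I. w i * x i powr p)"
proof -
  have "(\<Sum>i\<in>I. w i * ((x i powr p) powr (1 / p) * 1 powr (1 - 1 / p)))
    \<le> (\<Sum>i\<in>I. w i * x i powr p) powr (1 / p) * (\<Sum>i\<in>I. w i * 1) powr (1 - 1 / p)"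
    using assms by (intro weighted_Holder) auto
  then have "(\<Sum>i\<in>I. w i * x i) \<le> (\<Sum>i\<in>I. w i * x i powr p) powr (1 / p)"
    using p w x by (simp add: powr_powr)
  then have "(\<Sum>i\<in>I. w i * x i) powr p \<le> ((\<Sum>i\<in>I. w i * x i powr p) powr (1 / p)) powr p"
    using p w x by (intro powr_mono2) (auto intro!: sum_nonneg)
  also have "\<dots> = (\<Sum>i\<in>I. w i * x i powr p)"
    using p w x by (simp add: powr_powr sum_nonneg)
  finally show ?thesis .
qed

text \<open>
  Convexity of the \<open>p\<close>-th power, used for the convex combination of \<open>x / A\<close> and \<open>y / B\<close> with
  coefficients proportional to the two norms \<open>A\<close> and \<open>B\<close>.
\<close>

lemma Minkowski_powr:
  fixes w x y :: "'i \<Rightarrow> real"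
  assumes fin: "finite I" and p: "1 \<le> p"
    and w: "\<And>i. i \<in> I \<Longrightarrow> 0 \<le> w i"
    and x: "\<And>i. i \<in> I \<Longrightarrow> 0 \<le> x i" and y: "\<And>i. i \<in> I \<Longrightarrow> 0 \<le> y i"
  shows "(\<Sum>i\<in>I. w i * (x i + y i) powr p) powr (1 / p)
    \<le> (\<Sum>i\<in>I. w i * x i powr p) powr (1 / p) + (\<Sum>i\<in>I. w i * y i powr p) powr (1 / p)"
proof -
  define S where "S z = (\<Sum>i\<in>I. w i * z i powr p)" for z :: "'i \<Rightarrow> real"
  define N where "N z = S z powr (1 / p)" for z
  have S0: "0 \<le> S z" for z unfolding S_def using w by (auto intro!: sum_nonneg)
  have SN: "S z = N z powr p" for z
    using p S0[of z] by (simp add: N_def powr_powr)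
  have zero: "w i * z i = 0" if "N z = 0" "i \<in> I" for i and z :: "'i \<Rightarrow> real"
  proof -
    have "S z = 0" using SN[of z] that by simp
    then have "w i * z i powr p = 0"
      using that fin w unfolding S_def by (subst (asm) sum_nonneg_eq_0_iff) auto
    then show ?thesis by auto
  qed
  have "N (\<lambda>i. x i + y i) \<le> N x + N y"
  proof (cases "N x = 0 \<or> N y = 0")
    case True
    then show ?thesis
    proof
      assume *: "N x = 0"
      have "S (\<lambda>i. x i + y i) = S y"
        unfolding S_def using zero[OF *] by (intro sum.cong refl) fastforce
      then show ?thesis using * by (simp add: N_def)
    next
      assume *: "N y = 0"
      have "S (\<lambda>i. x i + y i) = S x"
        unfolding S_def using zero[OF *] by (intro sum.cong refl) fastforce
      then show ?thesis using * by (simp add: N_def)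
    qed
  next
    case False
    then have pos: "0 < N x" "0 < N y" by (auto simp: N_def)
    define A B where "A = N x" and "B = N y"
    have A: "0 < A" "0 < B" using pos by (auto simp: A_def B_def)
    have conv: "(x i + y i) powr p
        \<le> (A + B) powr p * (A / (A + B) * (x i powr p / A powr p) + B / (A + B) * (y i powr p / B powr p))"
      if i: "i \<in> I" for i
    proof -
      have "(\<Sum>b\<in>{True, False}. (if b then A / (A + B) else B / (A + B)) * (if b then x i / A else y i / B)) powr p
         \<le> (\<Sum>b\<in>{True, False}. (if b then A / (A + B) else B / (A + B)) * (if b then x i / A else y i / B) powr p)"
        using A x[OF i] y[OF i] p
        by (intro powr_Jensen) (auto simp flip: add_divide_distrib)
      moreover have "A / (A + B) * (x i / A) + B / (A + B) * (y i / B) = (x i + y i) / (A + B)"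
        using A by (simp add: add_divide_distrib)
      ultimately have *: "((x i + y i) / (A + B)) powr p
          \<le> A / (A + B) * (x i powr p / A powr p) + B / (A + B) * (y i powr p / B powr p)"
        using A x[OF i] y[OF i] by (simp add: powr_divide)
      have "(x i + y i) powr p = (A + B) powr p * ((x i + y i) / (A + B)) powr p"
        using A x[OF i] y[OF i] by (simp add: powr_divide)
      also have "\<dots> \<le> (A + B) powr p * (A / (A + B) * (x i powr p / A powr p) + B / (A + B) * (y i powr p / B powr p))"
        using * by (intro mult_left_mono) auto
      finally show ?thesis .
    qed
    have "S (\<lambda>i. x i + y i) \<le> (\<Sum>i\<in>I. w i * ((A + B) powr p * (A / (A + B) * (x i powr p / A powr p) + B / (A + B) * (y i powr p / B powr p))))"
      unfolding S_def using conv w by (intro sum_mono mult_left_mono) auto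
    also have "\<dots> = (A + B) powr p * (A / (A + B) * (S x / A powr p) + B / (A + B) * (S y / B powr p))"
      unfolding S_def by (simp add: sum.distrib sum_distrib_left sum_divide_distrib algebra_simps)
    also have "\<dots> = (A + B) powr p"
      using A by (simp add: SN flip: A_def B_def add_divide_distrib)
    finally have "N (\<lambda>i. x i + y i) \<le> ((A + B) powr p) powr (1 / p)"
      unfolding N_def using p S0 by (intro powr_mono2) auto
    then show ?thesis using A p by (simp add: powr_powr A_def B_def)
  qed
  then show ?thesis by (simp add: N_def S_def)
qed

section \<open>The two-point inequality\<close>

text \<open>
  Up to second order both sides agree at \<open>y = 0\<close>. The second derivative of the difference is a
  multiple of \<open>(1 + y) powr (q - 2) + (1 - y) powr (q - 2) - 2\<close>, which is nonnegative by AM-GM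
  because \<open>1 - y\<^sup>2 \<le> 1\<close> and \<open>q \<le> 2\<close>.
\<close>

lemma powr_two_point_symmetric:
  assumes q: "1 \<le> q" "q \<le> 2" and y: "0 \<le> y" "y \<le> (1::real)"
  shows "1 + q * (q - 1) / 2 * y\<^sup>2 \<le> ((1 + y) powr q + (1 - y) powr q) / 2"
proof -
  define h where "h y = (1 + y) powr q + (1 - y) powr q - q * (q - 1) * y\<^sup>2" for y :: real
  define h' where "h' y = q * ((1 + y) powr (q - 1) - (1 - y) powr (q - 1) - 2 * (q - 1) * y)" for y :: real
  have d: "(h has_real_derivative h' y) (at y)" if "0 < y" "y < 1" for y
    unfolding h_def h'_def using that q
    by (auto intro!: derivative_eq_intros simp: algebra_simps)
  have d': "(h' has_real_derivative q * (q - 1) * ((1 + y) powr (q - 2) + (1 - y) powr (q - 2) - 2)) (at y)"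
    if "0 \<le> y" "y < 1" for y
    unfolding h'_def using that q
    by (auto intro!: derivative_eq_intros simp: algebra_simps)
  have am: "2 \<le> (1 + y) powr (q - 2) + (1 - y) powr (q - 2)" if "0 \<le> y" "y < 1" for y :: real
  proof -
    have "1 \<le> (1 - y\<^sup>2) powr ((q - 2) / 2)"
    proof -
      have "0 < 1 - y\<^sup>2" "1 - y\<^sup>2 \<le> 1" using that by (auto simp: abs_square_less_1)
      then show ?thesis using q powr_mono'[of "(q - 2) / 2" 0 "1 - y\<^sup>2"] by simp
    qed
    also have "(1 - y\<^sup>2) powr ((q - 2) / 2) = (1 + y) powr ((q - 2) / 2) * (1 - y) powr ((q - 2) / 2)"
      using that by (simp flip: powr_mult add: power2_eq_square algebra_simps)
    finally have "2 \<le> 2 * ((1 + y) powr ((q - 2) / 2) * (1 - y) powr ((q - 2) / 2))" by simp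
    also have "\<dots> \<le> ((1 + y) powr ((q - 2) / 2))\<^sup>2 + ((1 - y) powr ((q - 2) / 2))\<^sup>2"
      using sum_squares_bound[of "(1 + y) powr ((q - 2) / 2)" "(1 - y) powr ((q - 2) / 2)"] by simp
    also have "\<dots> = (1 + y) powr (q - 2) + (1 - y) powr (q - 2)"
      by (simp add: power2_eq_square flip: powr_add)
    finally show ?thesis .
  qed
  have h'0: "0 \<le> h' y" if "0 \<le> y" "y < 1" for y
  proof -
    have "h' 0 \<le> h' y"
    proof (rule DERIV_nonneg_imp_nondecreasing[OF that(1)])
      fix x assume "0 \<le> x" "x \<le> y"
      then have x: "0 \<le> x" "x < 1" using that by auto
      then have "0 \<le> q * (q - 1) * ((1 + x) powr (q - 2) + (1 - x) powr (q - 2) - 2)"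
        using am[of x] q by auto
      then show "\<exists>z. (h' has_real_derivative z) (at x) \<and> 0 \<le> z"
        using d'[OF x] by blast
    qed
    then show ?thesis by (simp add: h'_def)
  qed
  have "h 0 \<le> h y"
  proof (rule DERIV_nonneg_imp_increasing_open[OF y(1)])
    fix x assume "0 < x" "x < y"
    then show "\<exists>z. (h has_real_derivative z) (at x) \<and> 0 \<le> z"
      using d[of x] h'0[of x] y by (intro exI conjI) auto
  next
    show "continuous_on {0..y} h"
      unfolding h_def using q y by (intro continuous_intros continuous_on_powr') auto
  qed
  then show ?thesis by (simp add: h_def)
qed

text \<open>
  This is hypercontractivity on a two-point space, for the function with values \<open>A\<close> and \<open>B\<close>: the
  left-hand side is the squared \<open>L\<^sup>2\<close> norm of its image under the noise operator, and the exponent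
  on the right is \<open>q = 1 + r\<^sup>2\<close>. After scaling to mean \<open>1\<close> the function is \<open>1 \<plusminus> y\<close>, and nonnegativity
  forces \<open>y \<le> 1\<close>; after raising to the power \<open>q / 2\<close>, Bernoulli's inequality linearises the left-hand
  side, which leaves exactly \<open>powr_two_point_symmetric\<close>.
\<close>

lemma two_point_inequality:
  assumes r: "0 \<le> r" "r \<le> 1" and AB: "0 \<le> A" "0 \<le> (B::real)"
  shows "((A + B) / 2)\<^sup>2 + r\<^sup>2 * ((A - B) / 2)\<^sup>2
    \<le> ((A powr (1 + r\<^sup>2) + B powr (1 + r\<^sup>2)) / 2) powr (2 / (1 + r\<^sup>2))"
proof -
  define q where "q = 1 + r\<^sup>2"
  have q: "1 \<le> q" "q \<le> 2" using r by (auto simp: q_def power_le_one)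
  have main: "((A + B) / 2)\<^sup>2 + r\<^sup>2 * ((A - B) / 2)\<^sup>2 \<le> ((A powr q + B powr q) / 2) powr (2 / q)"
    if AB: "0 \<le> B" "B \<le> A" "0 < A" for A B
  proof -
    define s y where "s = (A + B) / 2" and "y = (A - B) / (A + B)"
    have s: "0 < s" using AB by (simp add: s_def)
    have y: "0 \<le> y" "y \<le> 1" using AB by (auto simp: y_def)
    have Ay: "A = s * (1 + y)" "B = s * (1 - y)"
      using AB by (auto simp: s_def y_def field_simps)
    have pw: "((1 + r\<^sup>2 * y\<^sup>2) powr (q / 2)) \<le> ((1 + y) powr q + (1 - y) powr q) / 2"
    proof -
      have "(1 + r\<^sup>2 * y\<^sup>2) powr (q / 2) * 1 powr (1 - q / 2) \<le> q / 2 * (1 + r\<^sup>2 * y\<^sup>2) + (1 - q / 2) * 1"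
        using q by (intro Youngs_inequality_0) (auto intro: add_pos_nonneg)
      also have "\<dots> = 1 + q * (q - 1) / 2 * y\<^sup>2" by (simp add: q_def algebra_simps)
      also have "\<dots> \<le> ((1 + y) powr q + (1 - y) powr q) / 2"
        by (rule powr_two_point_symmetric[OF q y])
      finally show ?thesis by simp
    qed
    have "((A + B) / 2)\<^sup>2 + r\<^sup>2 * ((A - B) / 2)\<^sup>2 = s\<^sup>2 * (1 + r\<^sup>2 * y\<^sup>2)"
      unfolding Ay by (simp add: power2_eq_square algebra_simps)
    also have "\<dots> = s\<^sup>2 * ((1 + r\<^sup>2 * y\<^sup>2) powr (q / 2)) powr (2 / q)"
      using q by (simp add: powr_powr)
    also have "\<dots> \<le> s\<^sup>2 * (((1 + y) powr q + (1 - y) powr q) / 2) powr (2 / q)"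
      using pw q by (intro mult_left_mono powr_mono2) auto
    also have "s\<^sup>2 = (s powr q) powr (2 / q)"
      using s q by (simp add: powr_powr powr_numeral)
    also have "(s powr q) powr (2 / q) * (((1 + y) powr q + (1 - y) powr q) / 2) powr (2 / q)
        = ((A powr q + B powr q) / 2) powr (2 / q)"
      using s y unfolding Ay by (simp add: powr_mult distrib_left flip: powr_mult)
    finally show ?thesis .
  qed
  consider "A = 0 \<and> B = 0" | "B \<le> A" "0 < A" | "A \<le> B" "0 < B" using AB by fastforce
  then have "((A + B) / 2)\<^sup>2 + r\<^sup>2 * ((A - B) / 2)\<^sup>2 \<le> ((A powr q + B powr q) / 2) powr (2 / q)"
  proof cases
    case 1 then show ?thesis by simp
  next
    case 2 then show ?thesis using main AB by simp
  next
    case 3 then show ?thesis using main[of A B] AB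
      using power2_commute[of A B] by (simp add: add.commute power_divide)
  qed
  then show ?thesis by (simp add: q_def)
qed

section \<open>The cube and its noise operators\<close>

lemma finite_cube [simp]: "finite (cube n)"
  by (simp add: cube_def finite_PiE)

lemma card_cube: "card (cube n) = 2 ^ n"
  by (simp add: cube_def card_PiE numeral_2_eq_2)

lemma cube_values: "\<epsilon> \<in> cube n \<Longrightarrow> j \<in> {1..n} \<Longrightarrow> \<epsilon> j = -1 \<or> \<epsilon> j = 1"
  unfolding cube_def by (auto dest!: PiE_mem)

lemma cube_square: "\<epsilon> \<in> cube n \<Longrightarrow> j \<in> {1..n} \<Longrightarrow> \<epsilon> j * \<epsilon> j = 1"
  using cube_values[of \<epsilon> n j] by auto

lemma flip_in_cube: "\<epsilon> \<in> cube n \<Longrightarrow> j \<in> {1..n} \<Longrightarrow> \<epsilon>(j := - \<epsilon> j) \<in> cube n"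
  unfolding cube_def PiE_iff extensional_def by auto

lemma sum_cube_flip:
  assumes "j \<in> {1..n}"
  shows "(\<Sum>\<epsilon>\<in>cube n. g (\<epsilon>(j := - \<epsilon> j))) = (\<Sum>\<epsilon>\<in>cube n. g \<epsilon>)"
  by (rule sum.reindex_bij_witness[where i = "\<lambda>\<epsilon>. \<epsilon>(j := - \<epsilon> j)" and j = "\<lambda>\<epsilon>. \<epsilon>(j := - \<epsilon> j)"])
    (use assms flip_in_cube in auto)

lemma sum_cube_prod:
  fixes g :: "nat \<Rightarrow> real \<Rightarrow> real"
  shows "(\<Sum>\<epsilon>\<in>cube n. \<Prod>i=1..n. g i (\<epsilon> i)) = (\<Prod>i=1..n. g i 1 + g i (- 1))"
proof -
  have "(\<Prod>i=1..n. g i 1 + g i (- 1)) = (\<Prod>i=1..n. \<Sum>y\<in>{-1, 1}. g i y)"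
    by (simp add: add.commute)
  also have "\<dots> = (\<Sum>\<epsilon>\<in>cube n. \<Prod>i=1..n. g i (\<epsilon> i))"
    unfolding cube_def by (rule prod_sum_PiE) auto
  finally show ?thesis by simp
qed

text \<open>
  The probability of moving from \<open>\<epsilon>\<close> to \<open>\<eta>\<close> when the coordinates are multiplied by independent signs
  of mean \<open>r\<close>. With \<open>r = exp (- t)\<close> this is the heat kernel of the cube at time \<open>t\<close>; in the parameter
  \<open>r\<close> it is a polynomial, the semigroup law is multiplication of parameters, and the whole flow from
  the mean (\<open>r = 0\<close>) to the identity (\<open>r = 1\<close>) takes place on a compact interval.
\<close>

definition noise_kernel :: "nat \<Rightarrow> real \<Rightarrow> (nat \<Rightarrow> real) \<Rightarrow> (nat \<Rightarrow> real) \<Rightarrow> real" where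
  "noise_kernel n r \<epsilon> \<eta> = (\<Prod>i=1..n. (1 + r * (\<epsilon> i * \<eta> i)) / 2)"

definition noise :: "nat \<Rightarrow> real \<Rightarrow> ((nat \<Rightarrow> real) \<Rightarrow> 'a::real_normed_vector) \<Rightarrow> (nat \<Rightarrow> real) \<Rightarrow> 'a" where
  "noise n r f \<epsilon> = (\<Sum>\<eta>\<in>cube n. noise_kernel n r \<epsilon> \<eta> *\<^sub>R f \<eta>)"

lemma noise_kernel_commute: "noise_kernel n r \<epsilon> \<eta> = noise_kernel n r \<eta> \<epsilon>"
  by (simp add: noise_kernel_def mult.commute)

lemma noise_kernel_nonneg:
  assumes "0 \<le> r" "r \<le> 1" "\<epsilon> \<in> cube n" "\<eta> \<in> cube n"
  shows "0 \<le> noise_kernel n r \<epsilon> \<eta>"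
  unfolding noise_kernel_def
proof (rule prod_nonneg)
  fix i assume "i \<in> {1..n}"
  then show "0 \<le> (1 + r * (\<epsilon> i * \<eta> i)) / 2"
    using cube_values[of \<epsilon> n i] cube_values[of \<eta> n i] assms by auto
qed

lemma noise_kernel_total: "(\<Sum>\<eta>\<in>cube n. noise_kernel n r \<epsilon> \<eta>) = 1"
  unfolding noise_kernel_def by (subst sum_cube_prod) (simp add: field_simps)

lemma noise_kernel_mean:
  assumes j: "j \<in> {1..n}"
  shows "(\<Sum>\<eta>\<in>cube n. noise_kernel n r \<epsilon> \<eta> * \<eta> j) = r * \<epsilon> j"
proof -
  have "(\<Sum>\<eta>\<in>cube n. noise_kernel n r \<epsilon> \<eta> * \<eta> j)
      = (\<Sum>\<eta>\<in>cube n. \<Prod>i=1..n. (1 + r * (\<epsilon> i * \<eta> i)) / 2 * (if i = j then \<eta> i else 1))"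
    unfolding noise_kernel_def prod.distrib using j by (simp add: prod.delta)
  also have "\<dots> = (\<Prod>i=1..n. if i = j then r * \<epsilon> i else 1)"
    by (subst sum_cube_prod) (intro prod.cong refl, simp add: field_simps)
  also have "\<dots> = r * \<epsilon> j" using j by (simp add: prod.delta)
  finally show ?thesis .
qed

text \<open>
  The sum factorises over the coordinates, and in one coordinate it is a two-term identity.
\<close>

lemma noise_kernel_semigroup:
  "(\<Sum>\<eta>\<in>cube n. noise_kernel n s \<epsilon> \<eta> * noise_kernel n r \<eta> \<zeta>) = noise_kernel n (s * r) \<epsilon> \<zeta>"
  unfolding noise_kernel_def prod.distrib[symmetric]
  by (subst sum_cube_prod) (auto intro!: prod.cong simp: field_simps)

lemma noise_kernel_flip:
  "noise_kernel n r (\<epsilon>(j := - \<epsilon> j)) (\<eta>(j := - \<eta> j)) = noise_kernel n r \<epsilon> \<eta>"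
  unfolding noise_kernel_def by (intro prod.cong refl) simp

lemma noise_zero: "noise n 0 f \<epsilon> = cube_expectation n f"
proof -
  have "noise_kernel n 0 \<epsilon> \<eta> = inverse (real (card (cube n)))" for \<eta>
    unfolding noise_kernel_def card_cube by (simp add: power_one_over inverse_eq_divide)
  then show ?thesis by (simp add: noise_def cube_expectation_def scaleR_sum_right)
qed

lemma noise_one:
  assumes "\<epsilon> \<in> cube n"
  shows "noise n 1 f \<epsilon> = f \<epsilon>"
proof -
  have "noise_kernel n 1 \<epsilon> \<eta> = (if \<eta> = \<epsilon> then 1 else 0)" if "\<eta> \<in> cube n" for \<eta>
  proof (cases "\<eta> = \<epsilon>")
    case True
    have "(1 + 1 * (\<epsilon> i * \<eta> i)) / 2 = 1" if "i \<in> {1..n}" for i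
      using cube_square[OF assms that] True by simp
    then have "noise_kernel n 1 \<epsilon> \<eta> = 1"
      unfolding noise_kernel_def by (intro prod.neutral) blast
    then show ?thesis using True by simp
  next
    case False
    have "\<exists>i\<in>{1..n}. \<eta> i \<noteq> \<epsilon> i"
    proof (rule ccontr)
      assume "\<not> ?thesis"
      then have "\<eta> = \<epsilon>"
        using that assms unfolding cube_def by (intro PiE_ext) auto
      with False show False ..
    qed
    then obtain i where i: "i \<in> {1..n}" "\<eta> i \<noteq> \<epsilon> i" by blast
    then have "\<epsilon> i * \<eta> i = -1"
      using cube_values[OF that i(1)] cube_values[OF assms i(1)] by auto
    then have "noise_kernel n 1 \<epsilon> \<eta> = 0"
      unfolding noise_kernel_def using i(1) by (intro prod_zero bexI[of _ i]) auto
    then show ?thesis using False by simp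
  qed
  then have "noise n 1 f \<epsilon> = (\<Sum>\<eta>\<in>cube n. if \<eta> = \<epsilon> then f \<eta> else 0)"
    unfolding noise_def by (intro sum.cong refl) simp
  then show ?thesis using assms by (simp add: sum.delta)
qed

lemma noise_noise: "noise n s (noise n r f) \<epsilon> = noise n (s * r) f \<epsilon>"
proof -
  have "noise n s (noise n r f) \<epsilon>
      = (\<Sum>\<zeta>\<in>cube n. (\<Sum>\<eta>\<in>cube n. noise_kernel n s \<epsilon> \<eta> * noise_kernel n r \<eta> \<zeta>) *\<^sub>R f \<zeta>)"
    unfolding noise_def scaleR_sum_right scaleR_sum_left by (subst sum.swap) simp
  then show ?thesis by (simp add: noise_kernel_semigroup noise_def)
qed

lemma discrete_deriv_noise:
  assumes "j \<in> {1..n}"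
  shows "discrete_deriv j (noise n r f) \<epsilon> = noise n r (discrete_deriv j f) \<epsilon>"
proof -
  have "noise n r f (\<epsilon>(j := - \<epsilon> j))
      = (\<Sum>\<eta>\<in>cube n. noise_kernel n r (\<epsilon>(j := - \<epsilon> j)) (\<eta>(j := - \<eta> j)) *\<^sub>R f (\<eta>(j := - \<eta> j)))"
    unfolding noise_def by (rule sum_cube_flip[OF assms, symmetric])
  then have "noise n r f (\<epsilon>(j := - \<epsilon> j)) = (\<Sum>\<eta>\<in>cube n. noise_kernel n r \<epsilon> \<eta> *\<^sub>R f (\<eta>(j := - \<eta> j)))"
    by (simp add: noise_kernel_flip)
  then show ?thesis
    by (simp add: discrete_deriv_def noise_def scaleR_sum_right scaleR_diff_right sum_subtractf)
qed

lemma norm_noise_le: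
  assumes "0 \<le> r" "r \<le> 1" "\<epsilon> \<in> cube n"
  shows "norm (noise n r f \<epsilon>) \<le> noise n r (\<lambda>\<eta>. norm (f \<eta>)) \<epsilon>"
  unfolding noise_def
  using assms by (intro order_trans[OF norm_sum] sum_mono) (simp add: noise_kernel_nonneg)

lemma noise_nonneg:
  fixes g :: "(nat \<Rightarrow> real) \<Rightarrow> real"
  assumes "0 \<le> r" "r \<le> 1" "\<epsilon> \<in> cube n" "\<And>\<eta>. \<eta> \<in> cube n \<Longrightarrow> 0 \<le> g \<eta>"
  shows "0 \<le> noise n r g \<epsilon>"
  unfolding noise_def using assms by (auto intro!: sum_nonneg mult_nonneg_nonneg noise_kernel_nonneg)

section \<open>Averages and norms on the cube\<close>

lemma cube_expectation_noise: "cube_expectation n (noise n r f) = cube_expectation n f"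
proof -
  have "(\<Sum>\<epsilon>\<in>cube n. noise n r f \<epsilon>)
      = (\<Sum>\<eta>\<in>cube n. (\<Sum>\<epsilon>\<in>cube n. noise_kernel n r \<eta> \<epsilon>) *\<^sub>R f \<eta>)"
    unfolding noise_def scaleR_sum_left by (subst sum.swap) (simp add: noise_kernel_commute)
  then show ?thesis by (simp add: cube_expectation_def noise_kernel_total)
qed

lemma cube_expectation_add:
  "cube_expectation n (\<lambda>\<epsilon>. f \<epsilon> + g \<epsilon>) = cube_expectation n f + cube_expectation n g"
  by (simp add: cube_expectation_def sum.distrib scaleR_add_right)

lemma cube_expectation_scaleR:
  "cube_expectation n (\<lambda>\<epsilon>. c *\<^sub>R f \<epsilon>) = c *\<^sub>R cube_expectation n f"
  by (simp add: cube_expectation_def scaleR_sum_right mult.commute)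

lemma cube_expectation_mult:
  "cube_expectation n (\<lambda>\<epsilon>. c * f \<epsilon>) = (c :: real) * cube_expectation n f"
  using cube_expectation_scaleR[of n c f] by simp

lemma cube_expectation_sum:
  "cube_expectation n (\<lambda>\<epsilon>. \<Sum>j\<in>J. f j \<epsilon>) = (\<Sum>j\<in>J. cube_expectation n (f j))"
  unfolding cube_expectation_def scaleR_sum_right by (rule sum.swap)

lemma cube_expectation_mono:
  fixes f g :: "(nat \<Rightarrow> real) \<Rightarrow> real"
  assumes "\<And>\<epsilon>. \<epsilon> \<in> cube n \<Longrightarrow> f \<epsilon> \<le> g \<epsilon>"
  shows "cube_expectation n f \<le> cube_expectation n g"
  unfolding cube_expectation_def using assms by (auto intro!: mult_left_mono sum_mono)

lemma cube_expectation_cong: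
  "(\<And>\<epsilon>. \<epsilon> \<in> cube n \<Longrightarrow> f \<epsilon> = g \<epsilon>) \<Longrightarrow> cube_expectation n f = cube_expectation n g"
  by (simp add: cube_expectation_def)

lemma cube_expectation_const: "cube_expectation n (\<lambda>\<epsilon>. c) = c"
  using card_cube[of n] by (simp only: cube_expectation_def sum_constant_scaleR) simp

lemma cube_expectation_nonneg:
  fixes f :: "(nat \<Rightarrow> real) \<Rightarrow> real"
  assumes "\<And>\<epsilon>. \<epsilon> \<in> cube n \<Longrightarrow> 0 \<le> f \<epsilon>"
  shows "0 \<le> cube_expectation n f"
  unfolding cube_expectation_def using assms by (auto intro!: mult_nonneg_nonneg sum_nonneg)

lemma cube_expectation_Holder:
  fixes u v :: "(nat \<Rightarrow> real) \<Rightarrow> real"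
  assumes "0 \<le> \<alpha>" "0 \<le> \<beta>" "\<alpha> + \<beta> = 1"
    and "\<And>\<epsilon>. \<epsilon> \<in> cube n \<Longrightarrow> 0 \<le> u \<epsilon>" "\<And>\<epsilon>. \<epsilon> \<in> cube n \<Longrightarrow> 0 \<le> v \<epsilon>"
  shows "cube_expectation n (\<lambda>\<epsilon>. u \<epsilon> powr \<alpha> * v \<epsilon> powr \<beta>)
    \<le> cube_expectation n u powr \<alpha> * cube_expectation n v powr \<beta>"
  using weighted_Holder[of "cube n" \<alpha> \<beta> "\<lambda>_. inverse (real (card (cube n)))" u v] assms
  by (simp add: cube_expectation_def sum_distrib_left)

lemma cube_Lnorm_nonneg: "0 \<le> cube_Lnorm n p f"
  by (simp add: cube_Lnorm_def)

lemma cube_Lnorm_powr: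
  assumes "1 \<le> p"
  shows "cube_Lnorm n p f powr p = cube_expectation n (\<lambda>\<epsilon>. norm (f \<epsilon>) powr p)"
  using assms by (simp add: cube_Lnorm_def powr_powr cube_expectation_nonneg)

lemma cube_Lnorm_le_iff:
  assumes "1 \<le> p" "0 \<le> c"
  shows "cube_Lnorm n p f \<le> c \<longleftrightarrow> cube_expectation n (\<lambda>\<epsilon>. norm (f \<epsilon>) powr p) \<le> c powr p"
proof -
  have "cube_Lnorm n p f \<le> c \<longleftrightarrow> cube_Lnorm n p f powr p \<le> c powr p"
    using assms cube_Lnorm_nonneg[of n p f] powr_mono2[of p "cube_Lnorm n p f" c]
      powr_less_mono2[of p c "cube_Lnorm n p f"] by linarith
  then show ?thesis by (simp add: cube_Lnorm_powr[OF assms(1)])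
qed

lemma cube_Lnorm_cong:
  "(\<And>\<epsilon>. \<epsilon> \<in> cube n \<Longrightarrow> f \<epsilon> = g \<epsilon>) \<Longrightarrow> cube_Lnorm n p f = cube_Lnorm n p g"
  unfolding cube_Lnorm_def
  by (intro arg_cong[where f = "\<lambda>x. x powr (1 / p)"] cube_expectation_cong) simp

lemma cube_Lnorm_mono:
  assumes "1 \<le> p" "\<And>\<epsilon>. \<epsilon> \<in> cube n \<Longrightarrow> norm (f \<epsilon>) \<le> norm (g \<epsilon>)"
  shows "cube_Lnorm n p f \<le> cube_Lnorm n p g"
  unfolding cube_Lnorm_def using assms
  by (intro powr_mono2 cube_expectation_mono cube_expectation_nonneg) auto

lemma cube_Lnorm_triangle:
  assumes "1 \<le> p"
  shows "cube_Lnorm n p (\<lambda>\<epsilon>. f \<epsilon> + g \<epsilon>) \<le> cube_Lnorm n p f + cube_Lnorm n p g"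
proof -
  have "cube_Lnorm n p (\<lambda>\<epsilon>. f \<epsilon> + g \<epsilon>) \<le> cube_Lnorm n p (\<lambda>\<epsilon>. norm (f \<epsilon>) + norm (g \<epsilon>))"
    using assms by (intro cube_Lnorm_mono) (auto intro: norm_triangle_ineq)
  also have "\<dots> \<le> cube_Lnorm n p f + cube_Lnorm n p g"
    using Minkowski_powr[of "cube n" p "\<lambda>_. inverse (real (card (cube n)))"
        "\<lambda>\<epsilon>. norm (f \<epsilon>)" "\<lambda>\<epsilon>. norm (g \<epsilon>)"] assms
    by (simp add: cube_Lnorm_def cube_expectation_def sum_distrib_left)
  finally show ?thesis .
qed

lemma cube_Lnorm_scaleR:
  assumes "1 \<le> p"
  shows "cube_Lnorm n p (\<lambda>\<epsilon>. c *\<^sub>R f \<epsilon>) = \<bar>c\<bar> * cube_Lnorm n p f"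
  using assms
  by (simp add: cube_Lnorm_def powr_mult cube_expectation_mult powr_powr cube_expectation_nonneg)

lemma cube_Lnorm_le_const:
  assumes "1 \<le> p" "0 \<le> c" "\<And>\<epsilon>. \<epsilon> \<in> cube n \<Longrightarrow> norm (f \<epsilon>) \<le> c"
  shows "cube_Lnorm n p f \<le> c"
proof -
  have "cube_Lnorm n p f \<le> cube_Lnorm n p (\<lambda>_. c)"
    using assms by (intro cube_Lnorm_mono) auto
  also have "\<dots> = c" using assms by (simp add: cube_Lnorm_def cube_expectation_const powr_powr)
  finally show ?thesis .
qed

section \<open>Hypercontractivity and interpolation\<close>

lemma cube_extend: "\<epsilon> \<in> cube n \<Longrightarrow> y = 1 \<or> y = - 1 \<Longrightarrow> \<epsilon>(Suc n := y) \<in> cube (Suc n)"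
  unfolding cube_def PiE_iff extensional_def by auto

lemma sum_cube_Suc:
  "(\<Sum>\<epsilon>\<in>cube (Suc n). F \<epsilon>)
    = (\<Sum>\<epsilon>\<in>cube n. F (\<epsilon>(Suc n := 1))) + (\<Sum>\<epsilon>\<in>cube n. F (\<epsilon>(Suc n := - 1)))"
proof -
  have "(\<Sum>\<epsilon>\<in>cube (Suc n). F \<epsilon>) = (\<Sum>(y, \<epsilon>)\<in>{1, - 1 :: real} \<times> cube n. F (\<epsilon>(Suc n := y)))"
  proof (rule sum.reindex_bij_witness[where i = "\<lambda>(y, \<epsilon>). \<epsilon>(Suc n := y)"
        and j = "\<lambda>\<epsilon>. (\<epsilon> (Suc n), \<epsilon>(Suc n := undefined))"], goal_cases)
    case (2 \<epsilon>)
    then show ?case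
      unfolding cube_def PiE_iff extensional_def by auto
  next
    case (3 z)
    then obtain y \<eta> where z: "z = (y, \<eta>)" "\<eta> \<in> cube n" by blast
    then have "\<eta> (Suc n) = undefined"
      unfolding cube_def by (intro PiE_arb) auto
    then show ?case by (simp add: z(1) fun_upd_idem)
  next
    case (4 z)
    then obtain y \<eta> where "z = (y, \<eta>)" "\<eta> \<in> cube n" "y = 1 \<or> y = - 1" by blast
    then show ?case by (simp add: cube_extend)
  qed simp_all
  also have "\<dots> = (\<Sum>y\<in>{1, - 1 :: real}. \<Sum>\<epsilon>\<in>cube n. F (\<epsilon>(Suc n := y)))"
    by (rule sum.cartesian_product[symmetric])
  finally show ?thesis by simp
qed

lemma cube_expectation_Suc:
  fixes F :: "(nat \<Rightarrow> real) \<Rightarrow> real"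
  shows "cube_expectation (Suc n) F
    = (cube_expectation n (\<lambda>\<epsilon>. F (\<epsilon>(Suc n := 1))) + cube_expectation n (\<lambda>\<epsilon>. F (\<epsilon>(Suc n := - 1)))) / 2"
  by (simp add: cube_expectation_def sum_cube_Suc card_cube field_simps)

lemma noise_kernel_Suc:
  "noise_kernel (Suc n) r (\<epsilon>(Suc n := x)) (\<eta>(Suc n := y))
    = (1 + r * (x * y)) / 2 * noise_kernel n r \<epsilon> \<eta>"
proof -
  have "(\<Prod>i=1..n. (1 + r * ((\<epsilon>(Suc n := x)) i * (\<eta>(Suc n := y)) i)) / 2)
      = (\<Prod>i=1..n. (1 + r * (\<epsilon> i * \<eta> i)) / 2)"
    by (intro prod.cong refl) simp
  then show ?thesis by (simp add: noise_kernel_def)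
qed

lemma noise_Suc:
  fixes v :: "(nat \<Rightarrow> real) \<Rightarrow> real"
  shows "noise (Suc n) r v (\<epsilon>(Suc n := x))
    = (1 + r * x) / 2 * noise n r (\<lambda>\<eta>. v (\<eta>(Suc n := 1))) \<epsilon>
    + (1 - r * x) / 2 * noise n r (\<lambda>\<eta>. v (\<eta>(Suc n := - 1))) \<epsilon>"
  unfolding noise_def sum_cube_Suc noise_kernel_Suc
  by (simp add: sum_distrib_left mult.assoc)

lemma cube_expectation_Cauchy_Schwarz:
  fixes u v :: "(nat \<Rightarrow> real) \<Rightarrow> real"
  assumes "\<And>\<epsilon>. \<epsilon> \<in> cube n \<Longrightarrow> 0 \<le> u \<epsilon>" "\<And>\<epsilon>. \<epsilon> \<in> cube n \<Longrightarrow> 0 \<le> v \<epsilon>"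
  shows "cube_expectation n (\<lambda>\<epsilon>. u \<epsilon> * v \<epsilon>)
    \<le> sqrt (cube_expectation n (\<lambda>\<epsilon>. (u \<epsilon>)\<^sup>2)) * sqrt (cube_expectation n (\<lambda>\<epsilon>. (v \<epsilon>)\<^sup>2))"
proof -
  have "cube_expectation n (\<lambda>\<epsilon>. u \<epsilon> * v \<epsilon>)
      = cube_expectation n (\<lambda>\<epsilon>. (u \<epsilon>)\<^sup>2 powr (1/2) * (v \<epsilon>)\<^sup>2 powr (1/2))"
    using assms by (intro cube_expectation_cong) (simp add: powr_half_sqrt)
  also have "\<dots> \<le> cube_expectation n (\<lambda>\<epsilon>. (u \<epsilon>)\<^sup>2) powr (1/2) * cube_expectation n (\<lambda>\<epsilon>. (v \<epsilon>)\<^sup>2) powr (1/2)"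
    by (rule cube_expectation_Holder) auto
  finally show ?thesis
    by (simp add: powr_half_sqrt cube_expectation_nonneg)
qed

text \<open>
  Induction on the dimension. Freezing the last coordinate of \<open>v\<close> gives two functions; the
  triangle inequality in \<open>L\<^sup>2\<close> reduces the noise in the last coordinate to the two numbers that are
  the norms of their images under the remaining noise. The two-point inequality applies to this pair
  of numbers, and the induction hypothesis bounds each of them.
\<close>

lemma noise_hypercontractive:
  fixes v :: "(nat \<Rightarrow> real) \<Rightarrow> real"
  assumes r: "0 \<le> r" "r \<le> 1" and v: "\<And>\<epsilon>. \<epsilon> \<in> cube n \<Longrightarrow> 0 \<le> v \<epsilon>"
  shows "cube_expectation n (\<lambda>\<epsilon>. (noise n r v \<epsilon>)\<^sup>2)
    \<le> cube_expectation n (\<lambda>\<epsilon>. v \<epsilon> powr (1 + r\<^sup>2)) powr (2 / (1 + r\<^sup>2))"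
  using v
proof (induction n arbitrary: v)
  case 0
  have "1 + r\<^sup>2 \<noteq> 0" by (smt (verit) zero_le_power2)
  then have q: "(1 + r\<^sup>2) * (2 / (1 + r\<^sup>2)) = 2" by (simp add: divide_simps)
  have "cube 0 = {\<lambda>_. undefined}" by (simp add: cube_def)
  then have "0 \<le> v (\<lambda>_. undefined)" using 0 by simp
  then have "(v (\<lambda>_. undefined) powr (1 + r\<^sup>2)) powr (2 / (1 + r\<^sup>2)) = (v (\<lambda>_. undefined))\<^sup>2"
    by (simp only: powr_powr q powr_numeral)
  then show ?case using \<open>cube 0 = _\<close>
    by (simp add: cube_expectation_def noise_def noise_kernel_def)
next
  case (Suc n)
  define q where "q = 1 + r\<^sup>2"
  have q: "1 \<le> q" by (simp add: q_def)
  define v1 v2 where "v1 = (\<lambda>\<eta>. v (\<eta>(Suc n := 1)))" and "v2 = (\<lambda>\<eta>. v (\<eta>(Suc n := - 1)))"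
  have v0: "0 \<le> v1 \<epsilon>" "0 \<le> v2 \<epsilon>" if "\<epsilon> \<in> cube n" for \<epsilon>
    unfolding v1_def v2_def using that by (auto intro!: Suc.prems cube_extend)
  define N1 N2 where "N1 = noise n r v1" and "N2 = noise n r v2"
  have N0: "0 \<le> N1 \<epsilon>" "0 \<le> N2 \<epsilon>" if "\<epsilon> \<in> cube n" for \<epsilon>
    unfolding N1_def N2_def using that v0 r by (auto intro!: noise_nonneg)
  define A B where "A = sqrt (cube_expectation n (\<lambda>\<epsilon>. (N1 \<epsilon>)\<^sup>2))"
    and "B = sqrt (cube_expectation n (\<lambda>\<epsilon>. (N2 \<epsilon>)\<^sup>2))"
  have AB0: "0 \<le> A" "0 \<le> B" unfolding A_def B_def by (auto intro!: cube_expectation_nonneg)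
  have AB2: "cube_expectation n (\<lambda>\<epsilon>. (N1 \<epsilon>)\<^sup>2) = A\<^sup>2" "cube_expectation n (\<lambda>\<epsilon>. (N2 \<epsilon>)\<^sup>2) = B\<^sup>2"
    unfolding A_def B_def by (auto simp: cube_expectation_nonneg)
  have powq: "X powr q \<le> Y" if "0 \<le> X" "X\<^sup>2 \<le> Y powr (2 / q)" "0 \<le> Y" for X Y :: real
  proof -
    have "X powr q = (X\<^sup>2) powr (q / 2)"
      using that by (simp add: powr_powr flip: powr_numeral)
    also have "\<dots> \<le> (Y powr (2 / q)) powr (q / 2)"
      using that q by (intro powr_mono2) auto
    also have "\<dots> = Y" using that q by (simp add: powr_powr)
    finally show ?thesis .
  qed
  have A: "A powr q \<le> cube_expectation n (\<lambda>\<epsilon>. v1 \<epsilon> powr q)"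
    using Suc.IH[of v1] v0 AB0 AB2
    by (intro powq cube_expectation_nonneg) (auto simp: q_def N1_def)
  have B: "B powr q \<le> cube_expectation n (\<lambda>\<epsilon>. v2 \<epsilon> powr q)"
    using Suc.IH[of v2] v0 AB0 AB2
    by (intro powq cube_expectation_nonneg) (auto simp: q_def N2_def)
  have "cube_expectation (Suc n) (\<lambda>\<epsilon>. (noise (Suc n) r v \<epsilon>)\<^sup>2)
      = cube_expectation n (\<lambda>\<epsilon>. (1 + r\<^sup>2) / 4 * (N1 \<epsilon>)\<^sup>2 + ((1 + r\<^sup>2) / 4 * (N2 \<epsilon>)\<^sup>2 + (1 - r\<^sup>2) / 2 * (N1 \<epsilon> * N2 \<epsilon>)))"
  proof -
    have "cube_expectation (Suc n) (\<lambda>\<epsilon>. (noise (Suc n) r v \<epsilon>)\<^sup>2)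
       = 1 / 2 * cube_expectation n (\<lambda>\<epsilon>. ((1 + r) / 2 * N1 \<epsilon> + (1 - r) / 2 * N2 \<epsilon>)\<^sup>2
         + ((1 - r) / 2 * N1 \<epsilon> + (1 + r) / 2 * N2 \<epsilon>)\<^sup>2)"
      unfolding cube_expectation_Suc noise_Suc cube_expectation_add
      by (simp add: N1_def N2_def v1_def v2_def)
    also have "\<dots> = cube_expectation n (\<lambda>\<epsilon>. 1 / 2 * (((1 + r) / 2 * N1 \<epsilon> + (1 - r) / 2 * N2 \<epsilon>)\<^sup>2
         + ((1 - r) / 2 * N1 \<epsilon> + (1 + r) / 2 * N2 \<epsilon>)\<^sup>2))"
      by (rule cube_expectation_mult[symmetric])
    also have "\<dots> = cube_expectation n (\<lambda>\<epsilon>. (1 + r\<^sup>2) / 4 * (N1 \<epsilon>)\<^sup>2 + ((1 + r\<^sup>2) / 4 * (N2 \<epsilon>)\<^sup>2 + (1 - r\<^sup>2) / 2 * (N1 \<epsilon> * N2 \<epsilon>)))"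
      by (intro cube_expectation_cong) (simp add: power2_eq_square field_simps)
    finally show ?thesis .
  qed
  also have "\<dots> = (1 + r\<^sup>2) / 4 * A\<^sup>2 + ((1 + r\<^sup>2) / 4 * B\<^sup>2
      + (1 - r\<^sup>2) / 2 * cube_expectation n (\<lambda>\<epsilon>. N1 \<epsilon> * N2 \<epsilon>))"
    by (simp only: cube_expectation_add cube_expectation_mult AB2)
  also have "\<dots> \<le> (1 + r\<^sup>2) / 4 * A\<^sup>2 + ((1 + r\<^sup>2) / 4 * B\<^sup>2 + (1 - r\<^sup>2) / 2 * (A * B))"
    using cube_expectation_Cauchy_Schwarz[of n N1 N2] N0 r
    by (intro add_left_mono mult_left_mono) (auto simp: A_def B_def power_le_one)
  also have "\<dots> = ((A + B) / 2)\<^sup>2 + r\<^sup>2 * ((A - B) / 2)\<^sup>2"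
    by (simp add: power2_eq_square field_simps)
  also have "\<dots> \<le> ((A powr q + B powr q) / 2) powr (2 / q)"
    using two_point_inequality[OF r AB0] by (simp add: q_def)
  also have "\<dots> \<le> cube_expectation (Suc n) (\<lambda>\<epsilon>. v \<epsilon> powr q) powr (2 / q)"
    using A B q unfolding cube_expectation_Suc v1_def v2_def
    by (intro powr_mono2) auto
  finally show ?case by (simp add: q_def)
qed

text \<open>
  Interpolation between the contraction from \<open>L\<^sup>1\<close> to \<open>L\<^sup>1\<close> and the hypercontractive bound from
  \<open>L\<^sup>q\<close> to \<open>L\<^sup>2\<close>, where \<open>q = 1 + r\<^sup>2\<close>. For a positive operator acting on a nonnegative function
  Hoelder's inequality takes the place of complex interpolation: \<open>g\<close> is split into a product of powers of one function
  controlled in \<open>L\<^sup>1\<close> and one controlled in \<open>L\<^sup>q\<close>, and Hoelder's inequality with the kernel as weight separates them. The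
  result bounds the \<open>L\<^sup>p\<close> norm of the image by an intermediate norm of \<open>g\<close>, which log-convexity in
  turn bounds by the \<open>L\<^sup>1\<close> and \<open>L\<^sup>p\<close> norms. The exponent \<open>\<theta>\<close> that comes out does not depend
  on \<open>p\<close>.
\<close>

lemma noise_interpolation:
  fixes g :: "(nat \<Rightarrow> real) \<Rightarrow> real"
  assumes r: "0 \<le> r" "r \<le> 1" and p: "1 \<le> p" "p \<le> 2"
    and g: "\<And>\<epsilon>. \<epsilon> \<in> cube n \<Longrightarrow> 0 \<le> g \<epsilon>"
    and \<theta>_def: "\<theta> = (1 - r\<^sup>2) / (1 + r\<^sup>2)"
  shows "cube_expectation n (\<lambda>\<epsilon>. noise n r g \<epsilon> powr p)
    \<le> cube_expectation n g powr (\<theta> * p) * cube_expectation n (\<lambda>\<epsilon>. g \<epsilon> powr p) powr (1 - \<theta>)"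
proof -
  define q where "q = 1 + r\<^sup>2"
  have q: "1 \<le> q" "q \<le> 2" using r by (auto simp: q_def power_le_one)
  have \<theta>: "\<theta> = (2 - q) / q" by (simp add: \<theta>_def q_def)
  have \<theta>01: "0 \<le> \<theta>" "\<theta> \<le> 1" using q by (auto simp: \<theta>)
  \<comment> \<open>The exponent \<open>m\<close> lies between \<open>1\<close> and \<open>p\<close>, with \<open>\<theta>\<close> as interpolation parameter:
    \<open>1 / m = \<theta> / 1 + (1 - \<theta>) / p\<close>.\<close>
  define k where "k = \<theta> + (1 - \<theta>) / p"
  define m where "m = 1 / k"
  have k: "0 < k"
  proof -
    have "k = \<theta> * (1 - 1 / p) + 1 / p" by (simp add: k_def diff_divide_distrib algebra_simps)
    moreover have "0 \<le> \<theta> * (1 - 1 / p)" "0 < 1 / p" using p \<theta>01 by auto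
    ultimately show ?thesis by linarith
  qed
  then have m: "0 < m" by (simp add: m_def)
  \<comment> \<open>These weights place \<open>L\<^sup>p\<close> between \<open>L\<^sup>1\<close> and \<open>L\<^sup>2\<close>: \<open>1 / p = \<alpha> / 1 + \<beta> / 2\<close>. They also place
    \<open>L\<^sup>m\<close> between \<open>L\<^sup>1\<close> and \<open>L\<^sup>q\<close>.\<close>
  define \<alpha> \<beta> where "\<alpha> = (2 - p) / p" and "\<beta> = 2 * (p - 1) / p"
  have \<alpha>\<beta>: "0 \<le> \<alpha>" "0 \<le> \<beta>" "\<alpha> + \<beta> = 1"
    using p by (auto simp: \<alpha>_def \<beta>_def field_simps)
  have kk: "\<alpha> + \<beta> / q = k"
    using p q by (simp add: \<alpha>_def \<beta>_def k_def \<theta> field_simps)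
  define u w where "u = (\<lambda>\<epsilon>. g \<epsilon> powr m)" and "w = (\<lambda>\<epsilon>. g \<epsilon> powr (m / q))"
  have u0: "0 \<le> u \<epsilon>" for \<epsilon> by (simp add: u_def)
  have split: "u \<epsilon> powr \<alpha> * w \<epsilon> powr \<beta> = g \<epsilon>" if "\<epsilon> \<in> cube n" for \<epsilon>
  proof -
    have "m * \<alpha> + m / q * \<beta> = m * (\<alpha> + \<beta> / q)" by (simp add: algebra_simps)
    also have "\<dots> = 1" using k by (simp add: kk m_def)
    finally show ?thesis
      using g[OF that] by (simp add: u_def w_def powr_powr flip: powr_add)
  qed
  have nn: "0 \<le> noise n r u \<epsilon>" "0 \<le> noise n r w \<epsilon>" "0 \<le> noise n r g \<epsilon>" if "\<epsilon> \<in> cube n" for \<epsilon>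
    using that r g by (auto intro!: noise_nonneg simp: u_def w_def)
  have pointwise: "noise n r g \<epsilon> powr p
      \<le> noise n r u \<epsilon> powr (2 - p) * (noise n r w \<epsilon>)\<^sup>2 powr (p - 1)" if \<epsilon>: "\<epsilon> \<in> cube n" for \<epsilon>
  proof -
    have "noise n r g \<epsilon> = (\<Sum>\<eta>\<in>cube n. noise_kernel n r \<epsilon> \<eta> * (u \<eta> powr \<alpha> * w \<eta> powr \<beta>))"
      unfolding noise_def by (intro sum.cong refl) (simp add: split)
    also have "\<dots> \<le> noise n r u \<epsilon> powr \<alpha> * noise n r w \<epsilon> powr \<beta>"
      using weighted_Holder[of "cube n" \<alpha> \<beta> "noise_kernel n r \<epsilon>" u w] \<alpha>\<beta> \<epsilon> r
      by (simp add: noise_def noise_kernel_nonneg u_def w_def)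
    finally have "noise n r g \<epsilon> powr p \<le> (noise n r u \<epsilon> powr \<alpha> * noise n r w \<epsilon> powr \<beta>) powr p"
      using nn[OF \<epsilon>] p by (intro powr_mono2) auto
    also have "\<dots> = noise n r u \<epsilon> powr (2 - p) * noise n r w \<epsilon> powr (2 * (p - 1))"
      using p by (simp add: powr_mult powr_powr \<alpha>_def \<beta>_def)
    also have "noise n r w \<epsilon> powr (2 * (p - 1)) = (noise n r w \<epsilon>)\<^sup>2 powr (p - 1)"
      using nn[OF \<epsilon>] by (simp add: powr_powr flip: powr_numeral)
    finally show ?thesis .
  qed
  define S where "S = cube_expectation n u"
  have S0: "0 \<le> S" unfolding S_def u_def by (auto intro!: cube_expectation_nonneg)
  have wq: "cube_expectation n (\<lambda>\<epsilon>. w \<epsilon> powr q) = S"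
    unfolding S_def using q by (intro cube_expectation_cong) (simp add: u_def w_def powr_powr)
  have "cube_expectation n (\<lambda>\<epsilon>. noise n r g \<epsilon> powr p)
      \<le> cube_expectation n (\<lambda>\<epsilon>. noise n r u \<epsilon> powr (2 - p) * (noise n r w \<epsilon>)\<^sup>2 powr (p - 1))"
    by (intro cube_expectation_mono pointwise)
  also have "\<dots> \<le> cube_expectation n (noise n r u) powr (2 - p)
      * cube_expectation n (\<lambda>\<epsilon>. (noise n r w \<epsilon>)\<^sup>2) powr (p - 1)"
    using nn p by (intro cube_expectation_Holder) auto
  also have "\<dots> \<le> S powr (2 - p) * (S powr (2 / q)) powr (p - 1)"
  proof (intro mult_mono powr_mono2)
    show "cube_expectation n (\<lambda>\<epsilon>. (noise n r w \<epsilon>)\<^sup>2) \<le> S powr (2 / q)"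
      using noise_hypercontractive[OF r, of n w] wq by (simp add: q_def w_def)
  qed (use p nn in \<open>auto simp: S_def cube_expectation_noise intro!: cube_expectation_nonneg u0\<close>)
  also have "\<dots> = S powr (p / m)"
  proof -
    have "2 - p + 2 / q * (p - 1) = p * (\<alpha> + \<beta> / q)"
      using p q by (simp add: \<alpha>_def \<beta>_def field_simps)
    also have "\<dots> = p / m" by (simp add: kk m_def)
    finally show ?thesis by (simp add: powr_powr flip: powr_add)
  qed
  also have "\<dots> \<le> (cube_expectation n g powr (\<theta> * m)
      * cube_expectation n (\<lambda>\<epsilon>. g \<epsilon> powr p) powr ((1 - \<theta>) * m / p)) powr (p / m)"
  proof -
    have "\<theta> * m + p * ((1 - \<theta>) * m / p) = m" using p by (simp add: field_simps)
    then have "S = cube_expectation n (\<lambda>\<epsilon>. g \<epsilon> powr (\<theta> * m) * (g \<epsilon> powr p) powr ((1 - \<theta>) * m / p))"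
      unfolding S_def u_def
      by (intro cube_expectation_cong) (simp only: powr_powr powr_add[symmetric])
    also have "\<dots> \<le> cube_expectation n g powr (\<theta> * m)
      * cube_expectation n (\<lambda>\<epsilon>. g \<epsilon> powr p) powr ((1 - \<theta>) * m / p)"
    proof (rule cube_expectation_Holder)
      have "\<theta> * m + (1 - \<theta>) * m / p = k * m" by (simp add: k_def algebra_simps)
      then show "\<theta> * m + (1 - \<theta>) * m / p = 1" using k by (simp add: m_def)
    qed (use \<theta>01 m p g in auto)
    finally show ?thesis using S0 m p by (intro powr_mono2) auto
  qed
  also have "\<dots> = cube_expectation n g powr (\<theta> * p)
      * cube_expectation n (\<lambda>\<epsilon>. g \<epsilon> powr p) powr (1 - \<theta>)"
    using m p by (simp add: powr_mult powr_powr)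
  finally show ?thesis .
qed

section \<open>The derivative of the noise semigroup\<close>

text \<open>
  The derivative of \<open>noise n r f \<epsilon>\<close> with respect to \<open>r\<close>, by logarithmic differentiation of the
  kernel. A factor \<open>1 + r * z\<close> with \<open>z = \<plusminus>1\<close> contributes \<open>z / (1 + r * z) = (z - r) / (1 - r\<^sup>2)\<close>:
  the sign \<open>z\<close> centred at its mean and divided by its variance.
\<close>

definition noise_deriv :: "nat \<Rightarrow> real \<Rightarrow> ((nat \<Rightarrow> real) \<Rightarrow> 'a::real_normed_vector) \<Rightarrow> (nat \<Rightarrow> real) \<Rightarrow> 'a" where
  "noise_deriv n r f \<epsilon>
    = (\<Sum>\<eta>\<in>cube n. (noise_kernel n r \<epsilon> \<eta> * (\<Sum>j=1..n. (\<epsilon> j * \<eta> j - r) / (1 - r\<^sup>2))) *\<^sub>R f \<eta>)"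

lemma noise_kernel_has_derivative:
  assumes r: "0 \<le> r" "r < 1" and \<epsilon>: "\<epsilon> \<in> cube n" and \<eta>: "\<eta> \<in> cube n"
  shows "((\<lambda>r. noise_kernel n r \<epsilon> \<eta>) has_real_derivative
    noise_kernel n r \<epsilon> \<eta> * (\<Sum>j=1..n. (\<epsilon> j * \<eta> j - r) / (1 - r\<^sup>2))) (at r)"
proof -
  have z: "\<epsilon> j * \<eta> j = 1 \<or> \<epsilon> j * \<eta> j = - 1" if "j \<in> {1..n}" for j
    using cube_values[OF \<epsilon> that] cube_values[OF \<eta> that] by auto
  have nz: "(1 + r * (\<epsilon> j * \<eta> j)) / 2 \<noteq> 0" if "j \<in> {1..n}" for j
    using z[OF that] r by auto
  have "((\<lambda>r. \<Prod>i=1..n. (1 + r * (\<epsilon> i * \<eta> i)) / 2) has_real_derivative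
      (\<Prod>i=1..n. (1 + r * (\<epsilon> i * \<eta> i)) / 2)
        * (\<Sum>j=1..n. (\<epsilon> j * \<eta> j / 2) / ((1 + r * (\<epsilon> j * \<eta> j)) / 2))) (at r)"
    using nz by (intro has_field_derivative_prod') (auto intro!: derivative_eq_intros)
  moreover have "(\<epsilon> j * \<eta> j / 2) / ((1 + r * (\<epsilon> j * \<eta> j)) / 2) = (\<epsilon> j * \<eta> j - r) / (1 - r\<^sup>2)"
    if "j \<in> {1..n}" for j
  proof -
    have fac: "1 - r\<^sup>2 = (1 + r) * (1 - r)" by (simp add: power2_eq_square algebra_simps)
    have 1: "(1 - r) / (1 - r\<^sup>2) = 1 / (1 + r)" and 2: "(- 1 - r) / (1 - r\<^sup>2) = - (1 / (1 - r))"
      unfolding fac using r by (auto simp: divide_simps)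
    from z[OF that] show ?thesis
    proof
      assume z: "\<epsilon> j * \<eta> j = 1"
      show ?thesis unfolding z 1 by simp
    next
      assume z: "\<epsilon> j * \<eta> j = - 1"
      show ?thesis unfolding z 2 by simp
    qed
  qed
  ultimately show ?thesis by (simp add: noise_kernel_def)
qed

lemma noise_has_vector_derivative:
  assumes "0 \<le> r" "r < 1" "\<epsilon> \<in> cube n"
  shows "((\<lambda>r. noise n r f \<epsilon>) has_vector_derivative noise_deriv n r f \<epsilon>) (at r)"
  unfolding noise_def noise_deriv_def
proof (rule has_vector_derivative_sum)
  fix \<eta> assume "\<eta> \<in> cube n"
  from has_vector_derivative_scaleR[OF noise_kernel_has_derivative[OF assms this]
      has_vector_derivative_const[of "f \<eta>"]]
  show "((\<lambda>r. noise_kernel n r \<epsilon> \<eta> *\<^sub>R f \<eta>) has_vector_derivative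
    (noise_kernel n r \<epsilon> \<eta> * (\<Sum>j=1..n. (\<epsilon> j * \<eta> j - r) / (1 - r\<^sup>2))) *\<^sub>R f \<eta>) (at r)"
    by simp
qed

text \<open>
  Both sides are derivatives of \<open>noise n (s * r) f \<epsilon>\<close> in \<open>s\<close>. At \<open>s = r\<close> this moves half of the noise
  onto \<open>f\<close> before differentiation, which is what makes room for hypercontractivity.
\<close>

lemma noise_deriv_noise:
  assumes s: "0 \<le> s" "s < 1" and r: "0 \<le> r" "r \<le> 1" and \<epsilon>: "\<epsilon> \<in> cube n"
  shows "noise_deriv n s (noise n r f) \<epsilon> = r *\<^sub>R noise_deriv n (s * r) f \<epsilon>"
proof -
  have "0 \<le> s * r" "s * r < 1"
    using s r by (auto intro: le_less_trans[OF mult_left_le])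
  then have "((\<lambda>s. noise n s f \<epsilon>) \<circ> (\<lambda>s. s * r) has_vector_derivative r *\<^sub>R noise_deriv n (s * r) f \<epsilon>) (at s)"
    using \<epsilon> by (intro vector_diff_chain_at noise_has_vector_derivative) (auto intro!: derivative_eq_intros)
  then have "((\<lambda>s. noise n s (noise n r f) \<epsilon>) has_vector_derivative r *\<^sub>R noise_deriv n (s * r) f \<epsilon>) (at s)"
    by (simp add: noise_noise o_def)
  with noise_has_vector_derivative[OF s \<epsilon>, of "noise n r f"] show ?thesis
    by (rule vector_derivative_unique_at)
qed

text \<open>
  In the variable \<open>z = \<epsilon> j * \<eta> j\<close> the weight is, up to factors that do not involve \<open>z\<close>,
  \<open>(1 + r * z) * (z - r) = (1 - r\<^sup>2) * z\<close>, which is odd because \<open>z\<^sup>2 = 1\<close>.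
\<close>

lemma noise_kernel_flip_weight:
  assumes j: "j \<in> {1..n}" and \<epsilon>: "\<epsilon> \<in> cube n" and \<eta>: "\<eta> \<in> cube n"
  shows "noise_kernel n r \<epsilon> (\<eta>(j := - \<eta> j)) * (\<epsilon> j * - \<eta> j - r)
    = - (noise_kernel n r \<epsilon> \<eta> * (\<epsilon> j * \<eta> j - r))"
proof -
  define R where "R = (\<Prod>i\<in>{1..n} - {j}. (1 + r * (\<epsilon> i * \<eta> i)) / 2)"
  have 1: "noise_kernel n r \<epsilon> \<eta> = (1 + r * (\<epsilon> j * \<eta> j)) / 2 * R"
    unfolding noise_kernel_def R_def using j by (intro prod.remove) auto
  have "(\<Prod>i\<in>{1..n} - {j}. (1 + r * (\<epsilon> i * (\<eta>(j := - \<eta> j)) i)) / 2) = R"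
    unfolding R_def by (intro prod.cong refl) simp
  then have 2: "noise_kernel n r \<epsilon> (\<eta>(j := - \<eta> j)) = (1 + r * (\<epsilon> j * - \<eta> j)) / 2 * R"
    unfolding noise_kernel_def using prod.remove[OF _ j, of "\<lambda>i. (1 + r * (\<epsilon> i * (\<eta>(j := - \<eta> j)) i)) / 2"]
    by simp
  define z where "z = \<epsilon> j * \<eta> j"
  have "z = 1 \<or> z = - 1"
    using cube_values[OF \<epsilon> j] cube_values[OF \<eta> j] by (auto simp: z_def)
  then have "(1 + r * - z) / 2 * R * (- z - r) = - ((1 + r * z) / 2 * R * (z - r))"
    by (elim disjE) (simp_all add: field_simps)
  then show ?thesis unfolding 1 2 z_def by (simp only: mult_minus_right)
qed

text \<open>
  Since the \<open>j\<close>-th weight is odd under flipping coordinate \<open>j\<close>, only the odd part of \<open>f\<close> in that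
  coordinate survives, and this is \<open>discrete_deriv j f\<close>. The derivative of the semigroup is thereby an
  average of sums \<open>\<Sum>j. (biased centred sign) * (derivative of f)\<close>, the kind of expression that the
  type property controls.
\<close>

lemma noise_deriv_gradient:
  assumes \<epsilon>: "\<epsilon> \<in> cube n"
  shows "noise_deriv n r f \<epsilon> = inverse (1 - r\<^sup>2) *\<^sub>R (\<Sum>\<eta>\<in>cube n. noise_kernel n r \<epsilon> \<eta> *\<^sub>R
    (\<Sum>j=1..n. (\<epsilon> j * \<eta> j - r) *\<^sub>R discrete_deriv j f \<eta>))"
proof -
  define c where "c j \<eta> = noise_kernel n r \<epsilon> \<eta> * (\<epsilon> j * \<eta> j - r)" for j \<eta>
  have grad: "(\<Sum>\<eta>\<in>cube n. c j \<eta> *\<^sub>R f \<eta>) = (\<Sum>\<eta>\<in>cube n. c j \<eta> *\<^sub>R discrete_deriv j f \<eta>)"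
    if j: "j \<in> {1..n}" for j
  proof -
    have "(\<Sum>\<eta>\<in>cube n. c j \<eta> *\<^sub>R f \<eta>) = (\<Sum>\<eta>\<in>cube n. c j (\<eta>(j := - \<eta> j)) *\<^sub>R f (\<eta>(j := - \<eta> j)))"
      by (rule sum_cube_flip[OF j, symmetric])
    also have "\<dots> = (\<Sum>\<eta>\<in>cube n. - (c j \<eta> *\<^sub>R f (\<eta>(j := - \<eta> j))))"
      using noise_kernel_flip_weight[OF j \<epsilon>, of _ r] by (intro sum.cong refl) (simp add: c_def)
    finally have *: "(\<Sum>\<eta>\<in>cube n. c j \<eta> *\<^sub>R f (\<eta>(j := - \<eta> j))) = - (\<Sum>\<eta>\<in>cube n. c j \<eta> *\<^sub>R f \<eta>)"
      by (simp add: sum_negf)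
    have "(\<Sum>\<eta>\<in>cube n. c j \<eta> *\<^sub>R discrete_deriv j f \<eta>)
        = ((\<Sum>\<eta>\<in>cube n. c j \<eta> *\<^sub>R f \<eta>) - (\<Sum>\<eta>\<in>cube n. c j \<eta> *\<^sub>R f (\<eta>(j := - \<eta> j)))) /\<^sub>R 2"
      unfolding discrete_deriv_def sum_subtractf[symmetric] scaleR_sum_right
      by (intro sum.cong refl) (simp add: scaleR_diff_right mult.commute)
    then show ?thesis unfolding * by (simp flip: scaleR_2)
  qed
  have "noise_deriv n r f \<epsilon> = inverse (1 - r\<^sup>2) *\<^sub>R (\<Sum>j=1..n. \<Sum>\<eta>\<in>cube n. c j \<eta> *\<^sub>R f \<eta>)"
    unfolding noise_deriv_def c_def scaleR_sum_right sum_distrib_left scaleR_sum_left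
    by (subst sum.swap) (simp add: divide_inverse mult_ac)
  also have "\<dots> = inverse (1 - r\<^sup>2) *\<^sub>R (\<Sum>j=1..n. \<Sum>\<eta>\<in>cube n. c j \<eta> *\<^sub>R discrete_deriv j f \<eta>)"
    using grad by simp
  also have "\<dots> = inverse (1 - r\<^sup>2) *\<^sub>R (\<Sum>\<eta>\<in>cube n. noise_kernel n r \<epsilon> \<eta> *\<^sub>R
    (\<Sum>j=1..n. (\<epsilon> j * \<eta> j - r) *\<^sub>R discrete_deriv j f \<eta>))"
    unfolding c_def scaleR_sum_right by (subst sum.swap) simp
  finally show ?thesis .
qed

section \<open>Symmetrization\<close>

text \<open>
  Exchanges between two points of the cube the coordinates that \<open>\<sigma>\<close> marks with \<open>-1\<close>. Applied
  simultaneously to both points this is an involution of pairs which multiplies their difference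
  coordinatewise by \<open>\<sigma>\<close>.
\<close>

definition coord_mix :: "(nat \<Rightarrow> real) \<Rightarrow> (nat \<Rightarrow> real) \<Rightarrow> (nat \<Rightarrow> real) \<Rightarrow> nat \<Rightarrow> real" where
  "coord_mix \<sigma> \<epsilon> \<epsilon>' i = (if \<sigma> i = 1 then \<epsilon> i else \<epsilon>' i)"

lemma coord_mix_in_cube: "\<epsilon> \<in> cube n \<Longrightarrow> \<epsilon>' \<in> cube n \<Longrightarrow> coord_mix \<sigma> \<epsilon> \<epsilon>' \<in> cube n"
  unfolding cube_def PiE_iff extensional_def coord_mix_def by auto

lemma coord_mix_involution: "coord_mix \<sigma> (coord_mix \<sigma> \<epsilon> \<epsilon>') (coord_mix \<sigma> \<epsilon>' \<epsilon>) = \<epsilon>"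
  by (auto simp: coord_mix_def)

lemma coord_mix_diff:
  assumes "\<sigma> \<in> cube n" "i \<in> {1..n}"
  shows "coord_mix \<sigma> \<epsilon> \<epsilon>' i - coord_mix \<sigma> \<epsilon>' \<epsilon> i = \<sigma> i * (\<epsilon> i - \<epsilon>' i)"
  using cube_values[OF assms] by (auto simp: coord_mix_def)

lemma coord_mix_kernel:
  "noise_kernel n r \<eta> (coord_mix \<sigma> \<epsilon> \<epsilon>') * noise_kernel n r \<eta> (coord_mix \<sigma> \<epsilon>' \<epsilon>)
    = noise_kernel n r \<eta> \<epsilon> * noise_kernel n r \<eta> \<epsilon>'"
  unfolding noise_kernel_def prod.distrib[symmetric]
  by (intro prod.cong refl) (simp add: coord_mix_def mult.commute)

text \<open>
  Two independent points with the same product law are exchangeable in each coordinate separately, so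
  the law of their difference is invariant under all sign changes. The assumption on \<open>F\<close> says that it
  reads only the coordinates in \<open>{1..n}\<close>.
\<close>

lemma noise_kernel_sign_invariance:
  fixes F :: "(nat \<Rightarrow> real) \<Rightarrow> real"
  assumes \<sigma>: "\<sigma> \<in> cube n" and F: "\<And>d d'. (\<And>i. i \<in> {1..n} \<Longrightarrow> d i = d' i) \<Longrightarrow> F d = F d'"
  shows "(\<Sum>\<epsilon>\<in>cube n. \<Sum>\<epsilon>'\<in>cube n. noise_kernel n r \<eta> \<epsilon> * noise_kernel n r \<eta> \<epsilon>' * F (\<lambda>i. \<epsilon> i - \<epsilon>' i))
    = (\<Sum>\<epsilon>\<in>cube n. \<Sum>\<epsilon>'\<in>cube n. noise_kernel n r \<eta> \<epsilon> * noise_kernel n r \<eta> \<epsilon>' * F (\<lambda>i. \<sigma> i * (\<epsilon> i - \<epsilon>' i)))"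
proof -
  let ?h = "\<lambda>(\<epsilon>, \<epsilon>'). (coord_mix \<sigma> \<epsilon> \<epsilon>', coord_mix \<sigma> \<epsilon>' \<epsilon>)"
  have Fmix: "F (\<lambda>i. \<sigma> i * (\<epsilon> i - \<epsilon>' i)) = F (\<lambda>i. coord_mix \<sigma> \<epsilon> \<epsilon>' i - coord_mix \<sigma> \<epsilon>' \<epsilon> i)" for \<epsilon> \<epsilon>'
    by (intro F) (simp add: coord_mix_diff[OF \<sigma>])
  show ?thesis
    unfolding sum.cartesian_product
  proof (rule sum.reindex_bij_witness[where i = ?h and j = ?h], goal_cases)
    case (5 z)
    then show ?case
      by (cases z) (simp add: Fmix coord_mix_involution coord_mix_kernel)
  qed (auto simp: coord_mix_in_cube coord_mix_involution)
qed

text \<open>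
  A difference of two signs is \<open>0\<close> or \<open>\<plusminus>2\<close>, so its \<open>p\<close>-th absolute power is
  \<open>2 powr p * (1 - \<epsilon> j * \<epsilon>' j) / 2\<close>. This is affine in each sign, so its average under the product law
  depends only on the mean of a single sign.
\<close>

lemma sum_noise_kernel_diff_powr:
  assumes j: "j \<in> {1..n}" and \<eta>: "\<eta> \<in> cube n"
  shows "(\<Sum>\<epsilon>\<in>cube n. \<Sum>\<epsilon>'\<in>cube n. noise_kernel n r \<eta> \<epsilon> * noise_kernel n r \<eta> \<epsilon>' * \<bar>\<epsilon> j - \<epsilon>' j\<bar> powr p)
    = 2 powr p * ((1 - r\<^sup>2) / 2)"
proof -
  let ?K = "noise_kernel n r \<eta>"
  have "(\<Sum>\<epsilon>\<in>cube n. \<Sum>\<epsilon>'\<in>cube n. ?K \<epsilon> * ?K \<epsilon>' * \<bar>\<epsilon> j - \<epsilon>' j\<bar> powr p)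
      = (\<Sum>\<epsilon>\<in>cube n. \<Sum>\<epsilon>'\<in>cube n. 2 powr p / 2 * (?K \<epsilon> * ?K \<epsilon>' - (?K \<epsilon> * \<epsilon> j) * (?K \<epsilon>' * \<epsilon>' j)))"
  proof (intro sum.cong refl)
    fix \<epsilon> \<epsilon>' assume "\<epsilon> \<in> cube n" "\<epsilon>' \<in> cube n"
    then show "?K \<epsilon> * ?K \<epsilon>' * \<bar>\<epsilon> j - \<epsilon>' j\<bar> powr p
        = 2 powr p / 2 * (?K \<epsilon> * ?K \<epsilon>' - (?K \<epsilon> * \<epsilon> j) * (?K \<epsilon>' * \<epsilon>' j))"
      using cube_values[of \<epsilon> n j] cube_values[of \<epsilon>' n j] j by auto
  qed
  also have "\<dots> = 2 powr p / 2 * ((\<Sum>\<epsilon>\<in>cube n. ?K \<epsilon>) * (\<Sum>\<epsilon>'\<in>cube n. ?K \<epsilon>')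
      - (\<Sum>\<epsilon>\<in>cube n. ?K \<epsilon> * \<epsilon> j) * (\<Sum>\<epsilon>'\<in>cube n. ?K \<epsilon>' * \<epsilon>' j))"
    by (simp only: sum_distrib_left[symmetric] sum_subtractf sum_product)
  also have "\<dots> = 2 powr p / 2 * (1 - r\<^sup>2 * (\<eta> j * \<eta> j))"
    by (simp only: noise_kernel_total noise_kernel_mean[OF j]) (simp add: power2_eq_square mult_ac)
  finally show ?thesis using cube_square[OF \<eta> j] by simp
qed

text \<open>
  Type \<open>p\<close> for centred biased signs. Subtracting an independent copy only increases the average, by
  Jensen; the resulting differences are symmetric, so that independent fair signs may be inserted and
  the type inequality applied to them with the differences held fixed.
\<close>

lemma biased_type_inequality:
  fixes x :: "nat \<Rightarrow> 'a::real_normed_vector"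
  assumes T: "T \<in> type_constants TYPE('a) p" and p: "1 \<le> p" and n: "1 \<le> n"
    and r: "0 \<le> r" "r \<le> 1" and \<eta>: "\<eta> \<in> cube n"
  shows "(\<Sum>\<epsilon>\<in>cube n. noise_kernel n r \<eta> \<epsilon> * norm (\<Sum>j=1..n. (\<epsilon> j * \<eta> j - r) *\<^sub>R x j) powr p)
    \<le> T powr p * (2 powr p * ((1 - r\<^sup>2) / 2)) * (\<Sum>j=1..n. norm (x j) powr p)"
proof -
  let ?K = "noise_kernel n r \<eta>"
  define y where "y j = \<eta> j *\<^sub>R x j" for j
  have K0: "0 \<le> ?K \<epsilon>" if "\<epsilon> \<in> cube n" for \<epsilon> using noise_kernel_nonneg r \<eta> that by blast
  define F where "F d = norm (\<Sum>j=1..n. d j *\<^sub>R y j) powr p" for d :: "nat \<Rightarrow> real"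
  have F_cong: "F d = F d'" if "\<And>i. i \<in> {1..n} \<Longrightarrow> d i = d' i" for d d'
  proof -
    have "(\<Sum>j=1..n. d j *\<^sub>R y j) = (\<Sum>j=1..n. d' j *\<^sub>R y j)"
    proof (rule sum.cong[OF refl])
      fix j assume "j \<in> {1..n}"
      then show "d j *\<^sub>R y j = d' j *\<^sub>R y j" using that[of j] by simp
    qed
    then show ?thesis by (simp only: F_def)
  qed
  have decouple: "norm (\<Sum>j=1..n. (\<epsilon> j * \<eta> j - r) *\<^sub>R x j) powr p \<le> (\<Sum>\<epsilon>'\<in>cube n. ?K \<epsilon>' * F (\<lambda>i. \<epsilon> i - \<epsilon>' i))"
    if "\<epsilon> \<in> cube n" for \<epsilon>
  proof -
    have coeff: "(\<Sum>\<epsilon>'\<in>cube n. ?K \<epsilon>' * ((\<epsilon> j - \<epsilon>' j) * \<eta> j)) = \<epsilon> j * \<eta> j - r"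
      if j: "j \<in> {1..n}" for j
    proof -
      have "(\<Sum>\<epsilon>'\<in>cube n. ?K \<epsilon>' * ((\<epsilon> j - \<epsilon>' j) * \<eta> j))
          = (\<epsilon> j * \<eta> j) * (\<Sum>\<epsilon>'\<in>cube n. ?K \<epsilon>') - \<eta> j * (\<Sum>\<epsilon>'\<in>cube n. ?K \<epsilon>' * \<epsilon>' j)"
        unfolding sum_distrib_left sum_subtractf[symmetric]
        by (intro sum.cong refl) (simp add: algebra_simps)
      also have "\<dots> = \<epsilon> j * \<eta> j - r * (\<eta> j * \<eta> j)"
        using noise_kernel_mean[OF j, of r \<eta>] by (simp add: noise_kernel_total)
      finally show ?thesis using cube_square[OF \<eta> j] by simp
    qed
    have "(\<Sum>j=1..n. (\<epsilon> j * \<eta> j - r) *\<^sub>R x j)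
        = (\<Sum>j=1..n. \<Sum>\<epsilon>'\<in>cube n. ?K \<epsilon>' *\<^sub>R ((\<epsilon> j - \<epsilon>' j) *\<^sub>R y j))"
    proof (rule sum.cong[OF refl])
      fix j assume j: "j \<in> {1..n}"
      show "(\<epsilon> j * \<eta> j - r) *\<^sub>R x j = (\<Sum>\<epsilon>'\<in>cube n. ?K \<epsilon>' *\<^sub>R ((\<epsilon> j - \<epsilon>' j) *\<^sub>R y j))"
        unfolding coeff[OF j, symmetric] scaleR_sum_left y_def by simp
    qed
    also have "\<dots> = (\<Sum>\<epsilon>'\<in>cube n. ?K \<epsilon>' *\<^sub>R (\<Sum>j=1..n. (\<epsilon> j - \<epsilon>' j) *\<^sub>R y j))"
      unfolding scaleR_sum_right by (rule sum.swap)
    finally have "norm (\<Sum>j=1..n. (\<epsilon> j * \<eta> j - r) *\<^sub>R x j)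
        \<le> (\<Sum>\<epsilon>'\<in>cube n. ?K \<epsilon>' * norm (\<Sum>j=1..n. (\<epsilon> j - \<epsilon>' j) *\<^sub>R y j))"
      using K0 by (auto intro!: sum_norm_le)
    then have "norm (\<Sum>j=1..n. (\<epsilon> j * \<eta> j - r) *\<^sub>R x j) powr p
        \<le> (\<Sum>\<epsilon>'\<in>cube n. ?K \<epsilon>' * norm (\<Sum>j=1..n. (\<epsilon> j - \<epsilon>' j) *\<^sub>R y j)) powr p"
      using p by (intro powr_mono2) auto
    also have "\<dots> \<le> (\<Sum>\<epsilon>'\<in>cube n. ?K \<epsilon>' * norm (\<Sum>j=1..n. (\<epsilon> j - \<epsilon>' j) *\<^sub>R y j) powr p)"
      using p K0 by (intro powr_Jensen) (auto simp: noise_kernel_total)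
    finally show ?thesis by (simp add: F_def)
  qed
  have type: "cube_expectation n (\<lambda>\<sigma>. F (\<lambda>i. \<sigma> i * d i)) \<le> T powr p * (\<Sum>j=1..n. \<bar>d j\<bar> powr p * norm (y j) powr p)" for d
  proof -
    have "cube_expectation n (\<lambda>\<sigma>. norm (\<Sum>j=1..n. \<sigma> j *\<^sub>R (d j *\<^sub>R y j)) powr p)
        \<le> T powr p * (\<Sum>j=1..n. norm (d j *\<^sub>R y j) powr p)"
      by (rule T[unfolded type_constants_def mem_Collect_eq, THEN conjunct2, rule_format, OF n])
    then show ?thesis by (simp add: F_def powr_mult)
  qed
  define Q where "Q = (\<lambda>G. \<Sum>\<epsilon>\<in>cube n. \<Sum>\<epsilon>'\<in>cube n. ?K \<epsilon> * ?K \<epsilon>' * G \<epsilon> \<epsilon>')"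
  have "(\<Sum>\<epsilon>\<in>cube n. ?K \<epsilon> * norm (\<Sum>j=1..n. (\<epsilon> j * \<eta> j - r) *\<^sub>R x j) powr p)
      \<le> (\<Sum>\<epsilon>\<in>cube n. ?K \<epsilon> * (\<Sum>\<epsilon>'\<in>cube n. ?K \<epsilon>' * F (\<lambda>i. \<epsilon> i - \<epsilon>' i)))"
    using decouple K0 by (intro sum_mono mult_left_mono) auto
  also have "\<dots> = Q (\<lambda>\<epsilon> \<epsilon>'. F (\<lambda>i. \<epsilon> i - \<epsilon>' i))"
    by (simp add: Q_def sum_distrib_left mult.assoc)
  also have "\<dots> = cube_expectation n (\<lambda>\<sigma>. Q (\<lambda>\<epsilon> \<epsilon>'. F (\<lambda>i. \<epsilon> i - \<epsilon>' i)))"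
    by (simp only: cube_expectation_const)
  also have "\<dots> = cube_expectation n (\<lambda>\<sigma>. Q (\<lambda>\<epsilon> \<epsilon>'. F (\<lambda>i. \<sigma> i * (\<epsilon> i - \<epsilon>' i))))"
    unfolding Q_def by (intro cube_expectation_cong noise_kernel_sign_invariance F_cong)
  also have "\<dots> = Q (\<lambda>\<epsilon> \<epsilon>'. cube_expectation n (\<lambda>\<sigma>. F (\<lambda>i. \<sigma> i * (\<epsilon> i - \<epsilon>' i))))"
    unfolding Q_def by (simp only: cube_expectation_sum cube_expectation_mult)
  also have "\<dots> \<le> Q (\<lambda>\<epsilon> \<epsilon>'. T powr p * (\<Sum>j=1..n. \<bar>\<epsilon> j - \<epsilon>' j\<bar> powr p * norm (y j) powr p))"
    unfolding Q_def using K0 by (intro sum_mono mult_left_mono type) auto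
  also have "\<dots> = T powr p * (\<Sum>j=1..n. Q (\<lambda>\<epsilon> \<epsilon>'. \<bar>\<epsilon> j - \<epsilon>' j\<bar> powr p) * norm (y j) powr p)"
  proof -
    have "Q (\<lambda>\<epsilon> \<epsilon>'. T powr p * (\<Sum>j=1..n. \<bar>\<epsilon> j - \<epsilon>' j\<bar> powr p * norm (y j) powr p))
       = (\<Sum>\<epsilon>\<in>cube n. \<Sum>\<epsilon>'\<in>cube n. \<Sum>j=1..n. T powr p * (?K \<epsilon> * ?K \<epsilon>' * \<bar>\<epsilon> j - \<epsilon>' j\<bar> powr p * norm (y j) powr p))"
      unfolding Q_def sum_distrib_left by (intro sum.cong refl) simp
    also have "\<dots> = (\<Sum>\<epsilon>\<in>cube n. \<Sum>j=1..n. \<Sum>\<epsilon>'\<in>cube n. T powr p * (?K \<epsilon> * ?K \<epsilon>' * \<bar>\<epsilon> j - \<epsilon>' j\<bar> powr p * norm (y j) powr p))"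
      by (intro sum.cong refl) (rule sum.swap)
    also have "\<dots> = (\<Sum>j=1..n. \<Sum>\<epsilon>\<in>cube n. \<Sum>\<epsilon>'\<in>cube n. T powr p * (?K \<epsilon> * ?K \<epsilon>' * \<bar>\<epsilon> j - \<epsilon>' j\<bar> powr p * norm (y j) powr p))"
      by (rule sum.swap)
    finally show ?thesis
      unfolding Q_def sum_distrib_left sum_distrib_right .
  qed
  also have "\<dots> = T powr p * (\<Sum>j=1..n. (2 powr p * ((1 - r\<^sup>2) / 2)) * norm (x j) powr p)"
  proof -
    have "norm (y j) = norm (x j)" if "j \<in> {1..n}" for j
      using cube_values[OF \<eta> that] by (auto simp: y_def)
    then show ?thesis
      unfolding Q_def using \<eta>
      by (intro arg_cong[where f = "\<lambda>z. T powr p * z"] sum.cong refl) (simp only: sum_noise_kernel_diff_powr)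
  qed
  finally show ?thesis by (simp add: sum_distrib_left mult.assoc)
qed

section \<open>Integration along the semigroup\<close>

text \<open>
  The \<open>L\<^sup>p\<close> norm on the cube is a seminorm depending on the parameter \<open>p\<close> rather than the norm of a
  type, and the target space need not be complete, so the estimate is obtained without integrals:
  differentiability gives it up to an error \<open>e\<close> on short intervals around each point, and subadditivity
  propagates it from short intervals to the whole interval by bisection.
\<close>

lemma cube_Lnorm_mean_value:
  fixes \<phi> \<phi>' :: "real \<Rightarrow> (nat \<Rightarrow> real) \<Rightarrow> 'a::real_normed_vector"
  assumes p: "1 \<le> p" and ab: "a \<le> b"
    and \<phi>: "\<And>t \<epsilon>. a \<le> t \<Longrightarrow> t \<le> b \<Longrightarrow> \<epsilon> \<in> cube n \<Longrightarrow> ((\<lambda>t. \<phi> t \<epsilon>) has_vector_derivative \<phi>' t \<epsilon>) (at t)"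
    and G: "\<And>t. a \<le> t \<Longrightarrow> t \<le> b \<Longrightarrow> (G has_real_derivative G' t) (at t)"
    and le: "\<And>t. a \<le> t \<Longrightarrow> t \<le> b \<Longrightarrow> cube_Lnorm n p (\<phi>' t) \<le> G' t"
  shows "cube_Lnorm n p (\<lambda>\<epsilon>. \<phi> b \<epsilon> - \<phi> a \<epsilon>) \<le> G b - G a"
proof -
  have approx: "cube_Lnorm n p (\<lambda>\<epsilon>. \<phi> b \<epsilon> - \<phi> a \<epsilon>) \<le> G b - G a + 2 * e * (b - a)" if e: "0 < e" for e
  proof -
    define P where "P u v \<longleftrightarrow> (u \<le> v \<longrightarrow> cube_Lnorm n p (\<lambda>\<epsilon>. \<phi> v \<epsilon> - \<phi> u \<epsilon>) \<le> G v - G u + 2 * e * (v - u))" for u v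
    have "P a b"
    proof (rule Bolzano[OF ab])
      fix u v w assume "P u v" "P v w" "u \<le> v" "v \<le> w"
      moreover have "cube_Lnorm n p (\<lambda>\<epsilon>. \<phi> w \<epsilon> - \<phi> u \<epsilon>)
          \<le> cube_Lnorm n p (\<lambda>\<epsilon>. \<phi> w \<epsilon> - \<phi> v \<epsilon>) + cube_Lnorm n p (\<lambda>\<epsilon>. \<phi> v \<epsilon> - \<phi> u \<epsilon>)"
        using cube_Lnorm_triangle[OF p, of n "\<lambda>\<epsilon>. \<phi> w \<epsilon> - \<phi> v \<epsilon>" "\<lambda>\<epsilon>. \<phi> v \<epsilon> - \<phi> u \<epsilon>"] by simp
      ultimately show "P u w" by (simp add: P_def algebra_simps)
    next
      fix t assume t: "a \<le> t" "t \<le> b"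
      have "\<exists>d>0. \<forall>s. \<bar>s - t\<bar> < d \<longrightarrow> norm (\<phi> s \<epsilon> - \<phi> t \<epsilon> - (s - t) *\<^sub>R \<phi>' t \<epsilon>) \<le> e * \<bar>s - t\<bar>"
        if "\<epsilon> \<in> cube n" for \<epsilon>
        using \<phi>[OF t that] e
        unfolding has_vector_derivative_def has_derivative_at_alt by simp
      then obtain d where d: "\<And>\<epsilon>. \<epsilon> \<in> cube n \<Longrightarrow> 0 < d \<epsilon>"
        and d': "\<And>\<epsilon> s. \<epsilon> \<in> cube n \<Longrightarrow> \<bar>s - t\<bar> < d \<epsilon>
          \<Longrightarrow> norm (\<phi> s \<epsilon> - \<phi> t \<epsilon> - (s - t) *\<^sub>R \<phi>' t \<epsilon>) \<le> e * \<bar>s - t\<bar>"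
        by metis
      have "\<exists>d>0. \<forall>s. \<bar>s - t\<bar> < d \<longrightarrow> \<bar>G s - G t - (s - t) * G' t\<bar> \<le> e * \<bar>s - t\<bar>"
        using G[OF t] e
        unfolding has_field_derivative_def has_derivative_at_alt by (simp add: mult.commute)
      then obtain dG where dG: "0 < dG"
        and dG': "\<And>s. \<bar>s - t\<bar> < dG \<Longrightarrow> \<bar>G s - G t - (s - t) * G' t\<bar> \<le> e * \<bar>s - t\<bar>"
        by blast
      define D where "D = Min (insert dG (d ` cube n))"
      have D: "0 < D" unfolding D_def using d dG by (subst Min_gr_iff) auto
      have DG: "D \<le> dG" and Dd: "\<And>\<epsilon>. \<epsilon> \<in> cube n \<Longrightarrow> D \<le> d \<epsilon>" unfolding D_def by auto
      have "P u v" if uv: "u \<le> t" "t \<le> v" "v - u < D" for u v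
      proof -
        define R where "R \<epsilon> = (\<phi> v \<epsilon> - \<phi> t \<epsilon> - (v - t) *\<^sub>R \<phi>' t \<epsilon>) - (\<phi> u \<epsilon> - \<phi> t \<epsilon> - (u - t) *\<^sub>R \<phi>' t \<epsilon>)" for \<epsilon>
        have R: "norm (R \<epsilon>) \<le> e * (v - u)" if \<epsilon>: "\<epsilon> \<in> cube n" for \<epsilon>
        proof -
          have "norm (R \<epsilon>) \<le> e * \<bar>v - t\<bar> + e * \<bar>u - t\<bar>"
            unfolding R_def using uv Dd[OF \<epsilon>]
            by (intro order_trans[OF norm_triangle_ineq4] add_mono d' \<epsilon>) auto
          also have "\<dots> = e * (v - u)" using uv by (simp add: algebra_simps)
          finally show ?thesis .
        qed
        have "cube_Lnorm n p (\<lambda>\<epsilon>. \<phi> v \<epsilon> - \<phi> u \<epsilon>) = cube_Lnorm n p (\<lambda>\<epsilon>. (v - u) *\<^sub>R \<phi>' t \<epsilon> + R \<epsilon>)"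
          by (simp add: R_def algebra_simps)
        also have "\<dots> \<le> cube_Lnorm n p (\<lambda>\<epsilon>. (v - u) *\<^sub>R \<phi>' t \<epsilon>) + cube_Lnorm n p R"
          by (rule cube_Lnorm_triangle[OF p])
        also have "\<dots> \<le> (v - u) * G' t + e * (v - u)"
        proof (rule add_mono)
          show "cube_Lnorm n p (\<lambda>\<epsilon>. (v - u) *\<^sub>R \<phi>' t \<epsilon>) \<le> (v - u) * G' t"
            using uv le[OF t] by (simp add: cube_Lnorm_scaleR[OF p] mult_left_mono)
          show "cube_Lnorm n p R \<le> e * (v - u)"
            using R e uv by (intro cube_Lnorm_le_const[OF p]) auto
        qed
        also have "(v - u) * G' t \<le> G v - G u + e * (v - u)"
        proof -
          have "\<bar>G v - G t - (v - t) * G' t\<bar> \<le> e * \<bar>v - t\<bar>" "\<bar>G u - G t - (u - t) * G' t\<bar> \<le> e * \<bar>u - t\<bar>"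
            using uv DG dG'[of v] dG'[of u] by simp_all
          then show ?thesis using uv by (simp add: algebra_simps abs_le_iff)
        qed
        finally show ?thesis by (simp add: P_def algebra_simps)
      qed
      then show "\<exists>d>0. \<forall>u v. u \<le> t \<and> t \<le> v \<and> v - u < d \<longrightarrow> P u v"
        using D by blast
    qed
    then show ?thesis using ab by (simp add: P_def)
  qed
  show ?thesis
  proof (rule field_le_epsilon)
    fix e :: real assume e: "0 < e"
    have "0 < e / (2 * (b - a + 1))" using e ab by auto
    from approx[OF this] have "cube_Lnorm n p (\<lambda>\<epsilon>. \<phi> b \<epsilon> - \<phi> a \<epsilon>) \<le> G b - G a + e * ((b - a) / (b - a + 1))"
      using ab by (simp add: field_simps)
    also have "e * ((b - a) / (b - a + 1)) \<le> e * 1"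
      using e ab by (intro mult_left_mono) (auto simp: divide_le_eq_1)
    finally show "cube_Lnorm n p (\<lambda>\<epsilon>. \<phi> b \<epsilon> - \<phi> a \<epsilon>) \<le> G b - G a + e" by simp
  qed
qed

text \<open>
  By Jensen the norm may be taken inside the average over \<open>\<eta>\<close>. As the kernel is symmetric and the
  outer point is uniform, the roles of the two points can be exchanged: \<open>\<eta>\<close> becomes the uniform point,
  at which the derivatives are evaluated, and the biased signs have the law of the kernel at \<open>\<eta>\<close>.
\<close>

lemma cube_Lnorm_noise_deriv_le:
  fixes h :: "(nat \<Rightarrow> real) \<Rightarrow> 'a::real_normed_vector"
  assumes T: "T \<in> type_constants TYPE('a) p" and p: "1 \<le> p" "p \<le> 2" and n: "1 \<le> n"
    and r: "0 \<le> r" "r < 1"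
  shows "cube_Lnorm n p (noise_deriv n r h)
    \<le> 2 * T / sqrt (1 - r\<^sup>2)
      * (\<Sum>j=1..n. cube_expectation n (\<lambda>\<epsilon>. norm (discrete_deriv j h \<epsilon>) powr p)) powr (1 / p)"
proof -
  define d where "d = 1 - r\<^sup>2"
  have d: "0 < d" "d \<le> 1" using r by (auto simp: d_def abs_square_less_1)
  have T0: "0 \<le> T" using T by (simp add: type_constants_def)
  define S where "S = (\<Sum>j=1..n. cube_expectation n (\<lambda>\<epsilon>. norm (discrete_deriv j h \<epsilon>) powr p))"
  have S0: "0 \<le> S" unfolding S_def by (intro sum_nonneg cube_expectation_nonneg) auto
  define V where "V \<epsilon> \<eta> = norm (\<Sum>j=1..n. (\<epsilon> j * \<eta> j - r) *\<^sub>R discrete_deriv j h \<eta>)" for \<epsilon> \<eta>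
  define c where "c = T powr p * (2 powr p * (d / 2))"
  have pointwise: "norm (noise_deriv n r h \<epsilon>) powr p
      \<le> inverse d powr p * (\<Sum>\<eta>\<in>cube n. noise_kernel n r \<epsilon> \<eta> * V \<epsilon> \<eta> powr p)" if \<epsilon>: "\<epsilon> \<in> cube n" for \<epsilon>
  proof -
    have K0: "0 \<le> noise_kernel n r \<epsilon> \<eta>" if "\<eta> \<in> cube n" for \<eta>
      using noise_kernel_nonneg[OF r(1) _ \<epsilon> that] r by simp
    have "norm (noise_deriv n r h \<epsilon>) \<le> inverse d * (\<Sum>\<eta>\<in>cube n. noise_kernel n r \<epsilon> \<eta> * V \<epsilon> \<eta>)"
      unfolding noise_deriv_gradient[OF \<epsilon>] d_def[symmetric] V_def
      using K0 d by (auto intro!: mult_left_mono sum_norm_le)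
    then have "norm (noise_deriv n r h \<epsilon>) powr p
        \<le> (inverse d * (\<Sum>\<eta>\<in>cube n. noise_kernel n r \<epsilon> \<eta> * V \<epsilon> \<eta>)) powr p"
      using p by (intro powr_mono2) auto
    also have "\<dots> = inverse d powr p * (\<Sum>\<eta>\<in>cube n. noise_kernel n r \<epsilon> \<eta> * V \<epsilon> \<eta>) powr p"
      by (rule powr_mult)
    also have "\<dots> \<le> inverse d powr p * (\<Sum>\<eta>\<in>cube n. noise_kernel n r \<epsilon> \<eta> * V \<epsilon> \<eta> powr p)"
      using p K0 by (intro mult_left_mono powr_Jensen) (auto simp: noise_kernel_total V_def)
    finally show ?thesis .
  qed
  have "cube_expectation n (\<lambda>\<epsilon>. norm (noise_deriv n r h \<epsilon>) powr p)
      \<le> cube_expectation n (\<lambda>\<epsilon>. inverse d powr p * (\<Sum>\<eta>\<in>cube n. noise_kernel n r \<epsilon> \<eta> * V \<epsilon> \<eta> powr p))"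
    by (intro cube_expectation_mono pointwise)
  also have "\<dots> = inverse d powr p
      * cube_expectation n (\<lambda>\<eta>. \<Sum>\<epsilon>\<in>cube n. noise_kernel n r \<eta> \<epsilon> * V \<epsilon> \<eta> powr p)"
  proof -
    have "(\<Sum>\<epsilon>\<in>cube n. \<Sum>\<eta>\<in>cube n. noise_kernel n r \<epsilon> \<eta> * V \<epsilon> \<eta> powr p)
        = (\<Sum>\<eta>\<in>cube n. \<Sum>\<epsilon>\<in>cube n. noise_kernel n r \<eta> \<epsilon> * V \<epsilon> \<eta> powr p)"
      by (subst sum.swap, intro sum.cong refl, subst noise_kernel_commute, rule refl)
    then show ?thesis unfolding cube_expectation_mult unfolding cube_expectation_def by simp
  qed
  also have "\<dots> \<le> inverse d powr p
      * cube_expectation n (\<lambda>\<eta>. c * (\<Sum>j=1..n. norm (discrete_deriv j h \<eta>) powr p))"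
    unfolding V_def c_def d_def
    using r by (intro mult_left_mono cube_expectation_mono biased_type_inequality[OF T p(1) n]) auto
  also have "\<dots> = inverse d powr p * (c * S)"
    by (simp only: cube_expectation_mult cube_expectation_sum S_def)
  also have "\<dots> = (2 * T) powr p * S * (d powr (1 - p) / 2)"
  proof -
    have "inverse d powr p * d = d powr (1 - p)"
    proof -
      have "inverse d powr p = 1 / d powr p"
        using d by (simp only: inverse_eq_divide powr_divide powr_one_eq_one)
      then show ?thesis using d by (simp add: powr_diff)
    qed
    moreover have "inverse d powr p * (c * S) = (2 powr p * T powr p) * S * ((inverse d powr p * d) / 2)"
      unfolding c_def by simp
    ultimately show ?thesis by (simp only: powr_mult)
  qed
  also have "\<dots> \<le> (2 * T) powr p * S * d powr (- (p / 2))"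
  proof (intro mult_left_mono)
    have "d powr (1 - p) \<le> d powr (- (p / 2))"
      using d p by (intro powr_mono') auto
    then show "d powr (1 - p) / 2 \<le> d powr (- (p / 2))"
      using powr_ge_zero[of d "1 - p"] by linarith
  qed (use S0 in auto)
  also have "\<dots> = (2 * T / sqrt d * S powr (1 / p)) powr p"
  proof -
    have "sqrt d powr p = d powr (p / 2)" using d by (simp add: powr_powr flip: powr_half_sqrt)
    moreover have "(S powr (1 / p)) powr p = S" using p S0 by (simp add: powr_powr)
    ultimately show ?thesis by (simp only: powr_mult powr_divide powr_minus_divide) simp
  qed
  finally show ?thesis
    unfolding d_def[symmetric] S_def[symmetric] using p T0 S0 d
    by (subst cube_Lnorm_le_iff) auto
qed

text \<open>
  The derivatives commute with noise, and the norm of an average is at most the average of the norms,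
  so each term falls under the interpolation bound for a scalar function.
\<close>

lemma sum_deriv_noise_le:
  fixes f :: "(nat \<Rightarrow> real) \<Rightarrow> 'a::real_normed_vector"
  assumes p: "1 \<le> p" "p \<le> 2" and r: "0 \<le> r" "r \<le> 1"
    and L1: "\<And>j. j \<in> {1..n} \<Longrightarrow> cube_expectation n (\<lambda>\<epsilon>. norm (discrete_deriv j f \<epsilon>)) \<le> M * b j"
    and Lp: "\<And>j. j \<in> {1..n} \<Longrightarrow> cube_expectation n (\<lambda>\<epsilon>. norm (discrete_deriv j f \<epsilon>) powr p) \<le> b j powr p"
  shows "(\<Sum>j=1..n. cube_expectation n (\<lambda>\<epsilon>. norm (discrete_deriv j (noise n r f) \<epsilon>) powr p)) powr (1 / p)
    \<le> M powr ((1 - r\<^sup>2) / (1 + r\<^sup>2)) * (\<Sum>j=1..n. b j powr p) powr (1 / p)"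
proof -
  define \<theta> where "\<theta> = (1 - r\<^sup>2) / (1 + r\<^sup>2)"
  have "r\<^sup>2 \<le> 1" using r by (simp add: power_le_one)
  moreover have "0 < 1 + r\<^sup>2" by (simp add: add_pos_nonneg)
  ultimately have \<theta>: "0 \<le> \<theta>" "\<theta> \<le> 1" by (auto simp: \<theta>_def divide_simps)
  have term_le: "cube_expectation n (\<lambda>\<epsilon>. norm (discrete_deriv j (noise n r f) \<epsilon>) powr p)
      \<le> M powr (\<theta> * p) * b j powr p" if j: "j \<in> {1..n}" for j
  proof -
    let ?g = "\<lambda>\<epsilon>. norm (discrete_deriv j f \<epsilon>)"
    have "cube_expectation n (\<lambda>\<epsilon>. norm (discrete_deriv j (noise n r f) \<epsilon>) powr p)
        \<le> cube_expectation n (\<lambda>\<epsilon>. noise n r ?g \<epsilon> powr p)"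
      using p r unfolding discrete_deriv_noise[OF j]
      by (intro cube_expectation_mono powr_mono2 norm_noise_le) auto
    also have "\<dots> \<le> cube_expectation n ?g powr (\<theta> * p) * cube_expectation n (\<lambda>\<epsilon>. ?g \<epsilon> powr p) powr (1 - \<theta>)"
      by (intro noise_interpolation[OF r p]) (auto simp: \<theta>_def)
    also have "\<dots> \<le> (M * b j) powr (\<theta> * p) * (b j powr p) powr (1 - \<theta>)"
      using L1[OF j] Lp[OF j] \<theta> p by (intro mult_mono powr_mono2 cube_expectation_nonneg) auto
    also have "\<dots> = M powr (\<theta> * p) * b j powr (\<theta> * p + p * (1 - \<theta>))"
      by (simp only: powr_mult powr_powr powr_add mult.assoc)
    also have "\<theta> * p + p * (1 - \<theta>) = p" by (simp add: algebra_simps)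
    finally show ?thesis .
  qed
  have "(\<Sum>j=1..n. cube_expectation n (\<lambda>\<epsilon>. norm (discrete_deriv j (noise n r f) \<epsilon>) powr p)) powr (1 / p)
      \<le> (\<Sum>j=1..n. M powr (\<theta> * p) * b j powr p) powr (1 / p)"
    using p term_le by (intro powr_mono2 sum_mono sum_nonneg cube_expectation_nonneg) auto
  also have "\<dots> = M powr \<theta> * (\<Sum>j=1..n. b j powr p) powr (1 / p)"
    using p by (simp add: powr_mult powr_powr flip: sum_distrib_left)
  finally show ?thesis by (simp add: \<theta>_def)
qed

text \<open>
  The exponential \<open>M powr \<theta> = exp (- L * \<theta>)\<close> with \<open>L = ln (1 / M)\<close> is replaced by the larger
  \<open>1 / (1 + L * \<theta>)\<close>. Its integral over \<open>x\<close> has the same order in \<open>L\<close>, and its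
  antiderivative is elementary.
\<close>

lemma powr_le_trig_fraction:
  fixes M x :: real
  assumes M: "0 < M" "M \<le> 1"
  shows "M powr ((1 - (sin x)\<^sup>2) / (1 + (sin x)\<^sup>2))
    \<le> 2 / (2 * (sin x)\<^sup>2 + (1 + ln (1 / M)) * (cos x)\<^sup>2)"
proof -
  define L where "L = ln (1 / M)"
  have L: "0 \<le> L" unfolding L_def using M by (intro ln_ge_zero) simp
  define s where "s = (sin x)\<^sup>2"
  have s: "0 \<le> s" "s \<le> 1" "(cos x)\<^sup>2 = 1 - s"
    by (auto simp: s_def cos_squared_eq abs_square_le_1)
  define \<theta> where "\<theta> = (1 - s) / (1 + s)"
  have \<theta>: "0 \<le> \<theta>" using s by (simp add: \<theta>_def)
  have D: "0 < (1 + s) + L * (1 - s)" using s L by (intro add_pos_nonneg) auto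
  have "M powr \<theta> = inverse (exp (L * \<theta>))"
    using M by (simp add: powr_def L_def ln_div exp_minus[symmetric] mult.commute)
  also have "\<dots> \<le> inverse (1 + L * \<theta>)"
    using exp_ge_add_one_self[of "L * \<theta>"] L \<theta> by (intro le_imp_inverse_le) (auto intro: add_pos_nonneg)
  also have "1 + L * \<theta> = ((1 + s) + L * (1 - s)) / (1 + s)"
    using s by (simp add: \<theta>_def field_simps)
  also have "inverse \<dots> = (1 + s) / ((1 + s) + L * (1 - s))" by simp
  also have "\<dots> \<le> 2 / ((1 + s) + L * (1 - s))"
    using s D by (intro divide_right_mono) auto
  also have "(1 + s) + L * (1 - s) = 2 * s + (1 + L) * (1 - s)" by (simp add: algebra_simps)
  finally show ?thesis by (simp add: s(3) \<theta>_def L_def flip: s_def)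
qed

lemma trig_fraction_antiderivative:
  fixes k x :: real
  assumes k: "0 < k" and x: "0 \<le> x" "x < pi / 2"
  shows "((\<lambda>x. 2 / sqrt (2 * k) * arctan (sqrt (2 / k) * tan x)) has_real_derivative
    2 / (2 * (sin x)\<^sup>2 + k * (cos x)\<^sup>2)) (at x)"
proof -
  have c: "0 < cos x" using x by (intro cos_gt_zero_pi) auto
  have "((\<lambda>x. 2 / sqrt (2 * k) * arctan (sqrt (2 / k) * tan x)) has_real_derivative
    2 / sqrt (2 * k) * (inverse (1 + (sqrt (2 / k) * tan x)\<^sup>2) * (sqrt (2 / k) * inverse ((cos x)\<^sup>2)))) (at x)"
    using c by (intro DERIV_cmult) (auto intro!: derivative_eq_intros)
  moreover have "2 / sqrt (2 * k) * (inverse (1 + (sqrt (2 / k) * tan x)\<^sup>2) * (sqrt (2 / k) * inverse ((cos x)\<^sup>2)))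
      = 2 / (2 * (sin x)\<^sup>2 + k * (cos x)\<^sup>2)"
  proof -
    have 1: "2 / sqrt (2 * k) * sqrt (2 / k) = 2 / k"
      using k by (simp add: real_sqrt_divide real_sqrt_mult)
    have 2: "(1 + (sqrt (2 / k) * tan x)\<^sup>2) * (cos x)\<^sup>2 = (2 * (sin x)\<^sup>2 + k * (cos x)\<^sup>2) / k"
      using k c by (simp add: power_mult_distrib tan_def power_divide field_simps)
    have "2 / sqrt (2 * k) * (inverse (1 + (sqrt (2 / k) * tan x)\<^sup>2) * (sqrt (2 / k) * inverse ((cos x)\<^sup>2)))
        = (2 / sqrt (2 * k) * sqrt (2 / k)) * inverse ((1 + (sqrt (2 / k) * tan x)\<^sup>2) * (cos x)\<^sup>2)"
      by simp
    also have "\<dots> = 2 / (2 * (sin x)\<^sup>2 + k * (cos x)\<^sup>2)"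
      unfolding 1 2 using k by simp
    finally show ?thesis .
  qed
  ultimately show ?thesis by simp
qed

section \<open>The influence inequality\<close>

text \<open>
  The path \<open>x \<mapsto> noise n ((sin x)\<^sup>2) f\<close> runs from the mean of \<open>f\<close> at \<open>x = 0\<close> to \<open>f\<close> at \<open>x = pi / 2\<close>. In
  this parametrization the singular factor \<open>1 / sqrt (1 - (sin x)\<^sup>2)\<close> of the derivative bound cancels
  against the speed \<open>cos x\<close>, so that the length element is bounded by
  \<open>4 * T * B * M powr \<theta>\<close>, and the arctangent bounds its integral.
\<close>

lemma Talagrand_influence_type:
  fixes f :: "(nat \<Rightarrow> real) \<Rightarrow> 'a::real_normed_vector"
  assumes T: "T \<in> type_constants TYPE('a) p" and p: "1 \<le> p" "p \<le> 2" and n: "1 \<le> n"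
    and M: "0 < M" "M \<le> 1"
    and b: "\<And>j. j \<in> {1..n} \<Longrightarrow> 0 \<le> b j"
    and L1: "\<And>j. j \<in> {1..n} \<Longrightarrow> cube_Lnorm n 1 (discrete_deriv j f) \<le> M * b j"
    and Lp: "\<And>j. j \<in> {1..n} \<Longrightarrow> cube_Lnorm n p (discrete_deriv j f) \<le> b j"
  shows "cube_Lnorm n p (\<lambda>\<epsilon>. f \<epsilon> - cube_expectation n f)
    \<le> 2 * sqrt 2 * pi * T / sqrt (1 + ln (1 / M)) * (\<Sum>j=1..n. b j powr p) powr (1 / p)"
proof -
  have T0: "0 \<le> T" using T by (simp add: type_constants_def)
  define B where "B = (\<Sum>j=1..n. b j powr p) powr (1 / p)"
  define k where "k = 1 + ln (1 / M)"
  have "0 \<le> ln (1 / M)" using M by (intro ln_ge_zero) simp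
  then have k: "1 \<le> k" by (simp add: k_def)
  define \<phi> where "\<phi> x = noise n ((sin x)\<^sup>2) f" for x
  define \<phi>' where "\<phi>' x \<epsilon> = (2 * cos x) *\<^sub>R noise_deriv n (sin x) (noise n (sin x) f) \<epsilon>" for x \<epsilon>
  define G where "G x = 4 * T * B * (2 / sqrt (2 * k) * arctan (sqrt (2 / k) * tan x))" for x
  define G' where "G' x = 4 * T * B * (2 / (2 * (sin x)\<^sup>2 + k * (cos x)\<^sup>2))" for x
  define C where "C = 2 * sqrt 2 * pi * T / sqrt k * B"
  have range: "0 \<le> sin x" "sin x < 1" "0 < cos x" if "0 \<le> x" "x < pi / 2" for x :: real
  proof -
    show "0 \<le> sin x" using that by (intro sin_ge_zero) auto
    show c: "0 < cos x" using that by (intro cos_gt_zero_pi) auto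
    have "(sin x)\<^sup>2 < 1" using c by (simp add: sin_squared_eq)
    then show "sin x < 1" by (simp add: abs_square_less_1)
  qed
  have deriv: "((\<lambda>x. \<phi> x \<epsilon>) has_vector_derivative \<phi>' x \<epsilon>) (at x)"
    if x: "0 \<le> x" "x < pi / 2" and \<epsilon>: "\<epsilon> \<in> cube n" for x \<epsilon>
  proof -
    have "0 \<le> (sin x)\<^sup>2" "(sin x)\<^sup>2 < 1" using range[OF x] by (auto simp: abs_square_less_1)
    then have "((\<lambda>r. noise n r f \<epsilon>) \<circ> (\<lambda>x. (sin x)\<^sup>2) has_vector_derivative
        (2 * sin x * cos x) *\<^sub>R noise_deriv n ((sin x)\<^sup>2) f \<epsilon>) (at x)"
      using \<epsilon> by (intro vector_diff_chain_at noise_has_vector_derivative)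
        (auto intro!: derivative_eq_intros simp flip: has_real_derivative_iff_has_vector_derivative)
    moreover have "(2 * sin x * cos x) *\<^sub>R noise_deriv n ((sin x)\<^sup>2) f \<epsilon> = \<phi>' x \<epsilon>"
      unfolding \<phi>'_def using range[OF x] \<epsilon>
      by (subst noise_deriv_noise) (auto simp: power2_eq_square mult_ac)
    ultimately show ?thesis by (simp add: \<phi>_def o_def)
  qed
  have speed: "cube_Lnorm n p (\<phi>' x) \<le> G' x" if x: "0 \<le> x" "x < pi / 2" for x
  proof -
    note r = range[OF x]
    have "sqrt (1 - (sin x)\<^sup>2) = cos x" using r by (simp flip: cos_squared_eq)
    then have "cube_Lnorm n p (\<phi>' x) \<le> (2 * cos x) * (2 * T / cos x
      * (\<Sum>j=1..n. cube_expectation n (\<lambda>\<epsilon>. norm (discrete_deriv j (noise n (sin x) f) \<epsilon>) powr p)) powr (1 / p))"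
      using cube_Lnorm_noise_deriv_le[OF T p n r(1,2), of "noise n (sin x) f"] r(3)
      unfolding \<phi>'_def cube_Lnorm_scaleR[OF p(1)]
      by (intro mult_mono) (auto simp: cube_Lnorm_nonneg)
    also have "\<dots> = 4 * T
      * (\<Sum>j=1..n. cube_expectation n (\<lambda>\<epsilon>. norm (discrete_deriv j (noise n (sin x) f) \<epsilon>) powr p)) powr (1 / p)"
      using r(3) by simp
    also have "\<dots> \<le> 4 * T * (M powr ((1 - (sin x)\<^sup>2) / (1 + (sin x)\<^sup>2)) * B)"
    proof -
      have 1: "cube_expectation n (\<lambda>\<epsilon>. norm (discrete_deriv j f \<epsilon>)) \<le> M * b j" if "j \<in> {1..n}" for j
        using L1[OF that] by (simp add: cube_Lnorm_def cube_expectation_nonneg)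
      have 2: "cube_expectation n (\<lambda>\<epsilon>. norm (discrete_deriv j f \<epsilon>) powr p) \<le> b j powr p" if "j \<in> {1..n}" for j
        using Lp[OF that] p b[OF that] by (simp add: cube_Lnorm_le_iff)
      show ?thesis unfolding B_def using T0 r
        by (intro mult_left_mono sum_deriv_noise_le[OF p] 1 2) auto
    qed
    also have "\<dots> \<le> 4 * T * (2 / (2 * (sin x)\<^sup>2 + k * (cos x)\<^sup>2) * B)"
      unfolding k_def using T0
      by (intro mult_left_mono mult_right_mono powr_le_trig_fraction M) (auto simp: B_def)
    finally show ?thesis by (simp add: G'_def mult_ac)
  qed
  have partial: "cube_Lnorm n p (\<lambda>\<epsilon>. \<phi> x \<epsilon> - \<phi> 0 \<epsilon>) \<le> C" if x: "0 \<le> x" "x < pi / 2" for x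
  proof -
    have "cube_Lnorm n p (\<lambda>\<epsilon>. \<phi> x \<epsilon> - \<phi> 0 \<epsilon>) \<le> G x - G 0"
    proof (rule cube_Lnorm_mean_value[OF p(1) x(1), where \<phi>' = \<phi>'])
      fix t assume t: "0 \<le> t" "t \<le> x"
      then show "(G has_real_derivative G' t) (at t)"
        unfolding G_def G'_def using x k by (intro DERIV_cmult trig_fraction_antiderivative) auto
    qed (use x deriv speed in auto)
    also have "\<dots> = 4 * T * B * (2 / sqrt (2 * k)) * arctan (sqrt (2 / k) * tan x)"
      by (simp add: G_def)
    also have "\<dots> \<le> 4 * T * B * (2 / sqrt (2 * k)) * (pi / 2)"
      using arctan_ubound[of "sqrt (2 / k) * tan x"] T0 k
      by (intro mult_left_mono) (auto simp: B_def)
    also have "\<dots> = C"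
    proof -
      have "4 / sqrt (2 * k) = 2 * sqrt 2 / sqrt k"
        using k by (simp add: real_sqrt_mult field_simps)
      moreover have "4 * T * B * (2 / sqrt (2 * k)) * (pi / 2) = 4 / sqrt (2 * k) * (T * B * pi)"
        by simp
      ultimately show ?thesis by (simp only: C_def) simp
    qed
    finally show ?thesis .
  qed
  have C0: "0 \<le> C" using T0 k by (simp add: C_def B_def)
  define H where "H x = cube_expectation n (\<lambda>\<epsilon>. norm (\<phi> x \<epsilon> - \<phi> 0 \<epsilon>) powr p)" for x
  have "continuous_on UNIV H"
    unfolding H_def cube_expectation_def \<phi>_def noise_def noise_kernel_def using p
    by (intro continuous_intros continuous_on_powr') auto
  \<comment> \<open>The bound on the speed is only available before \<open>pi / 2\<close>, where the kernel degenerates;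
    the end point is reached by continuity.\<close>
  then have "(H \<longlongrightarrow> H (pi / 2)) (at_left (pi / 2))"
    by (auto simp: continuous_on_eq_continuous_at isCont_def intro: filterlim_at_withinI tendsto_within_subset)
  moreover have "\<forall>\<^sub>F x in at_left (pi / 2). H x \<le> C powr p"
  proof -
    have "\<forall>\<^sub>F x in at_left (pi / 2). x \<in> {0<..<pi / 2}"
      by (rule eventually_at_left_real) simp
    then show ?thesis
    proof eventually_elim
      case (elim x)
      then show ?case using partial[of x] p C0 by (simp add: cube_Lnorm_le_iff H_def)
    qed
  qed
  ultimately have "H (pi / 2) \<le> C powr p"
    by (rule tendsto_upperbound) simp
  then have "cube_Lnorm n p (\<lambda>\<epsilon>. \<phi> (pi / 2) \<epsilon> - \<phi> 0 \<epsilon>) \<le> C"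
    using p C0 by (simp add: cube_Lnorm_le_iff H_def)
  also have "cube_Lnorm n p (\<lambda>\<epsilon>. \<phi> (pi / 2) \<epsilon> - \<phi> 0 \<epsilon>) = cube_Lnorm n p (\<lambda>\<epsilon>. f \<epsilon> - cube_expectation n f)"
    by (intro cube_Lnorm_cong) (simp add: \<phi>_def noise_zero noise_one)
  finally show ?thesis by (simp add: C_def B_def k_def)
qed

theorem theorem2:
  fixes f :: "(nat \<Rightarrow> real) \<Rightarrow> 'a::real_normed_vector"
    and a b :: "nat \<Rightarrow> real"
    and p :: real and n :: nat
  assumes "1 \<le> p" and "p \<le> 2"
    and "has_rademacher_type TYPE('a) p"
    and "n \<ge> 1"
    and "\<And>j. j \<in> {1..n} \<Longrightarrow> 0 \<le> a j"
    and "\<And>j. j \<in> {1..n} \<Longrightarrow> 0 \<le> b j"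
    and "\<And>j. j \<in> {1..n} \<Longrightarrow> a j \<le> b j"
    and "\<And>j. j \<in> {1..n} \<Longrightarrow> cube_Lnorm n 1 (discrete_deriv j f) \<le> a j"
    and "\<And>j. j \<in> {1..n} \<Longrightarrow> cube_Lnorm n p (discrete_deriv j f) \<le> b j"
  shows "cube_Lnorm n p (\<lambda>\<epsilon>. f \<epsilon> - cube_expectation n f)
    \<le> (let M = (MAX j\<in>{1..n}. if b j = 0 then 0 else a j / b j) in
        if M = 0 then 0
        else 2 * exp 1 * sqrt (2 * pi) * type_const TYPE('a) p / sqrt (ln (exp 1 / M))
               * (\<Sum>k=1..n. b k powr p) powr (1 / p))"
proof -
  let ?T = "type_const TYPE('a) p"
  have T: "?T \<in> type_constants TYPE('a) p"
    by (rule type_const_in_type_constants[OF assms(3)])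
  then have T0: "0 \<le> ?T" by (simp add: type_constants_def)
  define M where "M = (MAX j\<in>{1..n}. if b j = 0 then 0 else a j / b j)"
  have ne: "{1..n} \<noteq> {}" using \<open>n \<ge> 1\<close> by simp
  have M_ge: "(if b j = 0 then 0 else a j / b j) \<le> M" if "j \<in> {1..n}" for j
    unfolding M_def using that by (intro Max_ge) auto
  \<comment> \<open>For \<open>b j = 0\<close> this uses \<open>a j \<le> b j\<close>, which makes the ratio a genuine \<open>0 / 0\<close>.\<close>
  have aM: "a j \<le> M * b j" if j: "j \<in> {1..n}" for j
    using M_ge[OF j] assms(5-7)[OF j] by (cases "b j = 0") (auto simp: divide_simps split: if_splits)
  have "0 \<le> (if b 1 = 0 then 0 else a 1 / b 1)" using assms(5,6)[of 1] \<open>n \<ge> 1\<close> by auto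
  then have M0: "0 \<le> M" using M_ge[of 1] \<open>n \<ge> 1\<close> by auto
  have "(if b j = 0 then 0 else a j / b j) \<le> 1" if "j \<in> {1..n}" for j
    using assms(6,7)[OF that] by (auto simp: divide_le_eq_1)
  then have M1: "M \<le> 1"
    unfolding M_def using ne by (intro Max.boundedI) blast+
  show ?thesis
  proof (cases "M = 0")
    case True
    have zero: "discrete_deriv j f \<epsilon> = 0" if j: "j \<in> {1..n}" and \<epsilon>: "\<epsilon> \<in> cube n" for j \<epsilon>
    proof -
      have "cube_Lnorm n 1 (discrete_deriv j f) \<le> 0"
        using assms(8)[OF j] aM[OF j] True by simp
      then have "(\<Sum>\<epsilon>\<in>cube n. norm (discrete_deriv j f \<epsilon>)) \<le> 0"
        by (simp add: cube_Lnorm_def cube_expectation_nonneg) (simp add: cube_expectation_def card_cube field_simps)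
      then have "(\<Sum>\<epsilon>\<in>cube n. norm (discrete_deriv j f \<epsilon>)) = 0"
        by (intro antisym sum_nonneg) auto
      then show ?thesis using \<epsilon> by (simp add: sum_nonneg_eq_0_iff)
    qed
    \<comment> \<open>All derivatives vanish, so the bounds \<open>b j\<close> may be replaced by \<open>0\<close>.\<close>
    have "cube_Lnorm n p (\<lambda>\<epsilon>. f \<epsilon> - cube_expectation n f)
        \<le> 2 * sqrt 2 * pi * ?T / sqrt (1 + ln (1 / 1)) * (\<Sum>j=1..n. 0 powr p) powr (1 / p)"
      using zero assms(1)
      by (intro Talagrand_influence_type[OF T assms(1,2,4)]) (auto intro!: cube_Lnorm_le_const)
    then show ?thesis unfolding M_def[symmetric] using True by simp
  next
    case False
    then have M: "0 < M" using M0 by simp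
    \<comment> \<open>This is where the constant is relaxed: \<open>sqrt pi \<le> 2 \<le> exp 1\<close>.\<close>
    have sq: "2 * sqrt 2 * pi \<le> 2 * exp 1 * sqrt (2 * pi)"
    proof -
      have "sqrt pi \<le> 2" using pi_less_4 by (intro real_le_lsqrt) auto
      also have "2 \<le> exp (1::real)" using exp_ge_add_one_self[of 1] by simp
      finally have "2 * sqrt 2 * (sqrt pi * sqrt pi) \<le> 2 * sqrt 2 * (exp 1 * sqrt pi)"
        by (intro mult_left_mono mult_right_mono) auto
      then show ?thesis by (simp add: real_sqrt_mult mult_ac)
    qed
    have "ln (exp 1 / M) = 1 + ln (1 / M)" using M by (simp add: ln_div)
    moreover have "cube_Lnorm n p (\<lambda>\<epsilon>. f \<epsilon> - cube_expectation n f)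
        \<le> 2 * sqrt 2 * pi * ?T / sqrt (1 + ln (1 / M)) * (\<Sum>j=1..n. b j powr p) powr (1 / p)"
      using assms M M1 aM order_trans[OF assms(8) aM]
      by (intro Talagrand_influence_type[OF T]) auto
    moreover have "2 * sqrt 2 * pi * ?T / sqrt (1 + ln (1 / M)) * (\<Sum>j=1..n. b j powr p) powr (1 / p)
        \<le> 2 * exp 1 * sqrt (2 * pi) * ?T / sqrt (1 + ln (1 / M)) * (\<Sum>j=1..n. b j powr p) powr (1 / p)"
      using sq T0 M M1
      by (intro mult_right_mono divide_right_mono) (auto simp del: real_sqrt_mult)
    ultimately show ?thesis unfolding M_def[symmetric] using False by (simp add: Let_def)
  qed
qed

end
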